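(* Let $1\le p<\infty$, $L>1$ and $\Lambda=\{\lambda_{mn}\}_{m,n\in\mathbb{Z}}=\sqrt{\pi/L}\,\mathbb{Z}^2$. Let $\mathcal{Z}=\{z_{mn}\}_{m,n\in\mathbb{Z}}\subseteq\mathbb{C}$ (repeated entries allowed) be a set satisfying the following two conditions: (i) (Perturbed lattice) For every $m,n\in\mathbb{Z}$, $|z_{mn}-\lambda_{mn}|\le T(|\lambda_{mn}|)$, where $T:[0,\infty)\to[1,\infty)$ is an absolutely continuous function such that $0\le T'(r)\le\frac1r$ for almost every $r>0$; (ii) (Separation) For every $z\in\mathbb{C}$ and $r\ge T(|z|)$, $$\#\{w\in\mathcal{Z}\cap B_r(z):\ S_{\mathcal{Z}}(w)\le S(|w|)\}\le\beta\frac{r^2}{(\log_* r)^2},$$ where $\beta\ge1$ and $S:[0,\infty)\to(0,\infty)$ is a decreasing function such that $-\log S(r)\le T(r)^2(\log_* T(r))^4$. Then, for every $f\in\mathcal{F}^p$, $$\|f\|_p^p\le C\sum_{m,n}\omega(m,n)\,|f(z_{mn})|^pe^{-\frac p2|z_{mn}|^2},$$ where $\omega(m,n)$ is given by $$\omega(m,n)=\exp\Big(C'\beta\,T(1+|z_{mn}|)^2\,\big(\log_* T(1+|z_{mn}|)\big)^4\Big),$$ and the constants $C,C'\ge1$ depend on $p,L$. Moreover, if $1<L<2$ one can take $\log_*\log_* C=\frac{C''\beta}{L-1}$ and $C',C''$ depending only on $p$.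
   Context: Notation: $\log_*(x)=\max\{1,\log x\}$; $B_r(z)$ is the disc in $\mathbb{C}$ with centre $z$ and radius $r$. The plane $\mathbb{R}^2$ is identified with $\mathbb{C}$, and the lattice points are $\lambda_{mn}=\sqrt{\pi/L}\,(m+in)$. Product separation: for $z\in\mathcal{Z}$, $S_{\mathcal{Z}}(z)=\prod_{w\in B_1(z)\cap\mathcal{Z}\setminus\{z\}}|z-w|$ (an empty product equals $1$); repeated entries of $\mathcal{Z}$ are counted with multiplicity, so that $S_{\mathcal{Z}}(z_{mn})=0$ if $z_{mn}=z_{m'n'}$ for some $(m',n')\ne(m,n)$. Fock space: for $1\le p<\infty$, $\mathcal{F}^p$ is the space of entire functions $f$ with $\|f\|_p^p=\frac{p}{2\pi}\int_{\mathbb{C}}|f(z)|^pe^{-p|z|^2/2}\,dA(z)<\infty$, where $dA$ is Lebesgue measure on $\mathbb{C}$.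
   Formalization: In the first assertion C may depend on β as well as on p and L (C' depends only on p, L), because a C independent of β is impossible: collapsing blocks of lattice points in a disc of radius exp(c√β) forces C to grow with β. *)

theory Defs
  imports "HOL-Complex_Analysis.Complex_Analysis"
begin

definition log_star :: "real \<Rightarrow> real"
  where "log_star x = max 1 (ln x)"

text \<open>
  \<open>HOL-Analysis\<close> has absolute continuity of measures only; this is the classical
  \<open>\<epsilon>\<close>-\<open>\<delta>\<close> notion for functions on an interval \<open>I\<close>.  If \<open>I = [0,\<infinity>)\<close> and
  \<open>0 \<le> T'(r) \<le> 1/r\<close> almost everywhere, it is equivalent to absolute continuity on
  each compact subinterval, since such a function is \<open>1\<close>-Lipschitz on \<open>[1,\<infinity>)\<close>.
\<close>
definition absolutely_continuous_on :: "real set \<Rightarrow> (real \<Rightarrow> real) \<Rightarrow> bool"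
  where "absolutely_continuous_on I f \<longleftrightarrow>
    (\<forall>\<epsilon>>0. \<exists>\<delta>>0. \<forall>(n::nat) (a::nat \<Rightarrow> real) (b::nat \<Rightarrow> real).
      (\<forall>k<n. a k \<le> b k \<and> {a k..b k} \<subseteq> I) \<longrightarrow>
      disjoint_family_on (\<lambda>k. {a k<..<b k}) {..<n} \<longrightarrow>
      (\<Sum>k<n. b k - a k) < \<delta> \<longrightarrow>
      (\<Sum>k<n. \<bar>f (b k) - f (a k)\<bar>) < \<epsilon>)"

definition lattice_point :: "real \<Rightarrow> int \<times> int \<Rightarrow> complex"
  where "lattice_point L = (\<lambda>(m, n). of_real (sqrt (pi / L)) * (of_int m + \<i> * of_int n))"

text \<open>
  A set \<open>Z\<close> with repeated entries is a family \<open>z :: int \<times> int \<Rightarrow> complex\<close>, and products,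
  cardinalities and sums over \<open>Z\<close> range over indices, which counts multiplicities.
  Under \<open>perturbed_lattice\<close> below \<open>T\<close> grows at most logarithmically, so only finitely
  many indices fall into any disc; hence neither \<open>\<Prod>\<close> nor \<open>card\<close> takes its default
  value for infinite sets.
\<close>
definition product_separation :: "(int \<times> int \<Rightarrow> complex) \<Rightarrow> int \<times> int \<Rightarrow> real"
  where "product_separation z i = (\<Prod>j\<in>{j. j \<noteq> i \<and> z j \<in> ball (z i) 1}. cmod (z i - z j))"

definition perturbed_lattice ::
    "real \<Rightarrow> (real \<Rightarrow> real) \<Rightarrow> (int \<times> int \<Rightarrow> complex) \<Rightarrow> bool"
  where "perturbed_lattice L T z \<longleftrightarrow>
    (\<forall>r\<ge>0. 1 \<le> T r) \<and>
    absolutely_continuous_on {0..} T \<and>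
    (AE r in lborel. 0 < r \<longrightarrow>
      (\<exists>D. (T has_real_derivative D) (at r) \<and> 0 \<le> D \<and> D \<le> 1 / r)) \<and>
    (\<forall>i. cmod (z i - lattice_point L i) \<le> T (cmod (lattice_point L i)))"

definition separation_condition ::
    "real \<Rightarrow> (real \<Rightarrow> real) \<Rightarrow> (real \<Rightarrow> real) \<Rightarrow> (int \<times> int \<Rightarrow> complex) \<Rightarrow> bool"
  where "separation_condition \<beta> T S z \<longleftrightarrow>
    (\<forall>r\<ge>0. 0 < S r) \<and>
    antimono_on {0..} S \<and>
    (\<forall>r\<ge>0. - ln (S r) \<le> (T r)\<^sup>2 * (log_star (T r)) ^ 4) \<and>
    (\<forall>c r. T (cmod c) \<le> r \<longrightarrow>
      real (card {i. z i \<in> ball c r \<and> product_separation z i \<le> S (cmod (z i))})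
        \<le> \<beta> * (r\<^sup>2 / (log_star r)\<^sup>2))"

definition fock_norm_pow :: "real \<Rightarrow> (complex \<Rightarrow> complex) \<Rightarrow> ennreal"
  where "fock_norm_pow p f = ennreal (p / (2 * pi)) *
    (\<integral>\<^sup>+ w. ennreal (cmod (f w) powr p * exp (- (p * (cmod w)\<^sup>2 / 2))) \<partial>lborel)"

definition fock_space :: "real \<Rightarrow> (complex \<Rightarrow> complex) set"
  where "fock_space p = {f. f holomorphic_on UNIV \<and> fock_norm_pow p f < \<infinity>}"

definition sampling_weight ::
    "real \<Rightarrow> real \<Rightarrow> (real \<Rightarrow> real) \<Rightarrow> (int \<times> int \<Rightarrow> complex) \<Rightarrow> int \<times> int \<Rightarrow> real"
  where "sampling_weight C' \<beta> T z i =
    exp (C' * \<beta> * (T (1 + cmod (z i)))\<^sup>2 * (log_star (T (1 + cmod (z i)))) ^ 4)"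

text \<open>The right-hand side may be infinite, so the sum is taken in \<open>ennreal\<close>.\<close>
definition sampling_inequality ::
    "real \<Rightarrow> real \<Rightarrow> real \<Rightarrow> real \<Rightarrow> (real \<Rightarrow> real) \<Rightarrow> (int \<times> int \<Rightarrow> complex)
      \<Rightarrow> (complex \<Rightarrow> complex) \<Rightarrow> bool"
  where "sampling_inequality p C C' \<beta> T z f \<longleftrightarrow>
    fock_norm_pow p f \<le> ennreal C *
      (\<Sum>\<^sub>\<infinity>i\<in>UNIV. ennreal (sampling_weight C' \<beta> T z i * cmod (f (z i)) powr p
                        * exp (- (p / 2 * (cmod (z i))\<^sup>2))))"

end

theory Submission
  imports Defs
begin

text \<open>
Write \<open>\<Phi>(w) = |f(w)| exp(-|w|\<^sup>2/2)\<close>, \<open>l = min 1 (L - 1)\<close>, and let \<open>w\<close> be any point of the plane.  A Weyl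
translation moves \<open>w\<close> to the origin without changing \<open>\<Phi>\<close>.  In a disc of radius \<open>R\<close> about
\<open>w\<close> the function is interpolated at the well separated sampling points \<open>z\<^sub>j\<close>, those with
product separation above \<open>S\<close>.  What remains after subtracting the interpolant vanishes at these
points, so by a Jensen type estimate (\<open>interpolation_bound\<close>) its value at the centre is at most
the mean over the circle times the Blaschke product \<open>\<Prod> |z\<^sub>j - w| / R\<close>.

A point set of density \<open>L/\<pi>\<close> makes this product about \<open>exp(-L R\<^sup>2/2)\<close>, while the Gaussian
weight lets the translated function grow like \<open>exp(R\<^sup>2/2)\<close>.  As \<open>L > 1\<close> the product wins, and a
factor \<open>exp(-l R\<^sup>2/4)\<close> is left, provided that two errors are small against \<open>l R\<^sup>2\<close>
(\<open>blaschke_product_decay\<close>).  The displacement of the lattice costs \<open>R\<close> times \<open>T\<close>, which requires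
\<open>R\<close> to be a large multiple of \<open>T / l\<close>.  The discarded points cost \<open>\<beta> R\<^sup>2 / (ln R)\<^sup>2\<close>, which
requires \<open>(ln R)\<^sup>2\<close> to dominate \<open>\<beta> / l\<close>.  Here \<open>ln R\<close> is at least a multiple of \<open>\<beta> / l\<close>, so that
logarithms of \<open>R\<close> also absorb powers of \<open>1 / l\<close>; this lower bound on \<open>R\<close> is the origin of the doubly
exponential constant.  The interpolant is controlled by the separation products, by \<open>1/S\<close> for each
point, together with a factor \<open>(2R)\<close> to the number of points, that is \<open>exp(c R\<^sup>2 ln R)\<close>.
Raised to the power \<open>p\<close> (\<open>local_estimate\<close>), this bounds \<open>\<Phi>(w)\<^sup>p\<close> by a tiny multiple of the mean
of \<open>\<Phi>\<^sup>p\<close> over a circle plus a weighted sum of sample values.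

It remains to integrate over \<open>w\<close>.  The radius depends on \<open>w\<close>, but it is chosen in the discrete
set \<open>1024 n / l\<close> with natural \<open>n\<close>.  For fixed \<open>n\<close> the integral over all \<open>w\<close> of the circle means
of \<open>\<Phi>\<^sup>p\<close> is just the integral of \<open>\<Phi>\<^sup>p\<close>, by translation invariance, so bounding the coefficient
for \<open>n\<close> by \<open>2\<^sup>-\<^sup>n\<^sup>-\<^sup>2\<close> and summing over all \<open>n\<close> gives at most half of the norm, which is finite
and can be absorbed (\<open>absorb_circle_means\<close>).  In the sum over samples each point is charged on the disc of all
centres that use it; since \<open>T\<close> varies at most logarithmically, the radii at these centres are
comparable with the scale at the point itself, and the charge is of the form
\<open>exp(c (T\<^sup>2 (log\<^sub>* T)\<^sup>4 + exp(c \<beta> / l)))\<close>.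
\<close>

section \<open>Slowly varying majorants\<close>

text \<open>
Almost everywhere information on the derivative suffices for an absolutely continuous function.
On a fine tagged division (Cousin's lemma) an interval with tag off the exceptional null set
satisfies the inequality up to an error proportional to its length, by differentiability at the
tag.  The intervals with tags in the null set lie in an open set of small measure, so absolute
continuity makes their total contribution small.
\<close>
lemma absolutely_continuous_increment_le:
  fixes T \<phi> :: "real \<Rightarrow> real"
  assumes ac: "absolutely_continuous_on I T" and ab: "a \<le> b" and sub: "{a..b} \<subseteq> I"
    and mono: "\<And>x y. a \<le> x \<Longrightarrow> x \<le> y \<Longrightarrow> y \<le> b \<Longrightarrow> \<phi> x \<le> \<phi> y"
    and ae: "AE x in lborel. a < x \<and> x < b \<longrightarrow>
      (\<exists>D\<ge>0. ((\<lambda>x. \<phi> x - T x) has_real_derivative D) (at x))"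
  shows "T b - T a \<le> \<phi> b - \<phi> a"
proof (rule field_le_epsilon)
  fix e0 :: real assume e0: "e0 > 0"
  define h where "h = (\<lambda>x. \<phi> x - T x)"
  define e where "e = e0 / (b - a + 1)"
  have e: "e > 0" using e0 ab by (simp add: e_def)
  from ac e have "\<exists>\<delta>>0. \<forall>(n::nat) u v.
      (\<forall>k<n. u k \<le> v k \<and> {u k..v k} \<subseteq> I) \<longrightarrow>
      disjoint_family_on (\<lambda>k. {u k<..<v k}) {..<n} \<longrightarrow>
      (\<Sum>k<n. v k - u k) < \<delta> \<longrightarrow> (\<Sum>k<n. \<bar>T (v k) - T (u k)\<bar>) < e"
    unfolding absolutely_continuous_on_def by (elim allE[of _ e]) simp
  then obtain \<delta> where \<delta>: "\<delta> > 0" and ac\<delta>: "\<And>(n::nat) u v.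
      (\<forall>k<n. u k \<le> v k \<and> {u k..v k} \<subseteq> I) \<Longrightarrow>
      disjoint_family_on (\<lambda>k. {u k<..<v k}) {..<n} \<Longrightarrow>
      (\<Sum>k<n. v k - u k) < \<delta> \<Longrightarrow> (\<Sum>k<n. \<bar>T (v k) - T (u k)\<bar>) < e"
    by blast
  obtain N0 where N0: "{x. \<not> (a < x \<and> x < b \<longrightarrow>
      (\<exists>D\<ge>0. (h has_real_derivative D) (at x)))} \<subseteq> N0"
      "emeasure lborel N0 = 0" "N0 \<in> sets lborel"
    using AE_E[OF ae] unfolding h_def by auto
  define N where "N = N0 \<union> {a, b}"
  have Nborel: "N \<in> sets borel" using N0 by (simp add: N_def)
  have N0': "emeasure lborel N = 0"
  proof -
    have "emeasure lborel N \<le> emeasure lborel N0 + emeasure lborel {a,b}"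
      unfolding N_def by (rule emeasure_subadditive) (use N0 in auto)
    also have "\<dots> = 0" using N0 by (simp add: emeasure_lborel_countable)
    finally show ?thesis by simp
  qed
  obtain U where U: "open U" "N \<subseteq> U" "emeasure lborel (U - N) < \<delta>"
    using outer_regular_lborel[OF Nborel \<delta>] by metis
  have emU: "emeasure lborel U < \<delta>"
  proof -
    have "emeasure lborel U \<le> emeasure lborel ((U - N) \<union> N)"
      by (rule emeasure_mono) (use U Nborel in auto)
    also have "\<dots> \<le> emeasure lborel (U - N) + emeasure lborel N"
      by (rule emeasure_subadditive) (use U Nborel in auto)
    also have "\<dots> < \<delta>" using U N0' by simp
    finally show ?thesis .
  qed
  have loc: "\<exists>d>0. \<forall>u v. u \<in> ball x d \<and> v \<in> ball x d \<and> u \<le> x \<and> x \<le> v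
      \<longrightarrow> h v - h u \<ge> - e * (v - u)" if x: "x \<in> {a..b}" "x \<notin> N" for x
  proof -
    have "a < x" "x < b" using x unfolding N_def by auto
    then obtain D where D: "D \<ge> 0" "(h has_real_derivative D) (at x)"
      using N0(1) x unfolding N_def by auto
    then have "(h has_derivative (\<lambda>t. D * t)) (at x)"
      by (simp add: has_field_derivative_def)
    then obtain d where d: "d > 0" "\<And>y. norm (y - x) < d \<Longrightarrow>
        norm (h y - h x - D * (y - x)) \<le> e * norm (y - x)"
      using e unfolding has_derivative_at_alt by blast
    have "h v - h u \<ge> - e * (v - u)"
      if uv: "u \<in> ball x d" "v \<in> ball x d" "u \<le> x" "x \<le> v" for u v
    proof -
      have 1: "h v - h x - D * (v - x) \<ge> - e * (v - x)"
        using d(2)[of v] uv by (auto simp: dist_real_def)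
      have 2: "h u - h x - D * (u - x) \<le> e * (x - u)"
        using d(2)[of u] uv by (auto simp: dist_real_def)
      have "D * (v - x) \<ge> 0" "D * (x - u) \<ge> 0" using D uv by auto
      with 1 2 show ?thesis by (simp add: algebra_simps)
    qed
    with d show ?thesis by blast
  qed
  have "\<forall>x\<in>{a..b} - N. \<exists>d>0. \<forall>u v. u \<in> ball x d \<and> v \<in> ball x d \<and> u \<le> x \<and> x \<le> v
      \<longrightarrow> h v - h u \<ge> - e * (v - u)"
    using loc by simp
  from bchoice[OF this] obtain d where d: "\<And>x. x \<in> {a..b} \<Longrightarrow> x \<notin> N \<Longrightarrow> d x > 0"
    and d': "\<And>x u v. x \<in> {a..b} \<Longrightarrow> x \<notin> N \<Longrightarrow> u \<in> ball x (d x) \<Longrightarrow> v \<in> ball x (d x) \<Longrightarrow>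
      u \<le> x \<Longrightarrow> x \<le> v \<Longrightarrow> h v - h u \<ge> - e * (v - u)"
    by blast
  \<comment> \<open>Intervals tagged in the null set are forced into \<open>U\<close>.\<close>
  define g where "g = (\<lambda>x. if x \<in> N then U else if x \<in> {a..b} then ball x (d x) else UNIV)"
  have "gauge g" unfolding gauge_def g_def using U d by auto
  then obtain p where p: "p tagged_division_of {a..b}" "g fine p"
    using fine_division_exists_real by blast
  have finp: "finite p" using p(1) by auto
  have iv: "\<exists>u v. K = {u..v} \<and> u \<le> v \<and> u \<le> x \<and> x \<le> v \<and> a \<le> u \<and> v \<le> b \<and> {u..v} \<subseteq> g x"
    if xK: "(x, K) \<in> p" for x K
  proof -
    obtain u v where K: "K = cbox u v" using tagged_division_ofD(4)[OF p(1) xK] by blast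
    have "x \<in> K" "K \<subseteq> {a..b}" using tagged_division_ofD(2,3)[OF p(1) xK] by auto
    moreover have "K \<subseteq> g x" using p(2) xK by (auto simp: fine_def)
    ultimately show ?thesis using K by (intro exI[of _ u] exI[of _ v]) auto
  qed
  define q where "q = {xk \<in> p. fst xk \<in> N}"
  have qp: "q \<subseteq> p" "finite q" using finp by (auto simp: q_def)
  obtain enum where en: "bij_betw enum {..<card q} q"
    using ex_bij_betw_nat_finite[OF qp(2)] by (auto simp: atLeast0LessThan)
  define lo where "lo = (\<lambda>k. Inf (snd (enum k)))"
  define up where "up = (\<lambda>k. Sup (snd (enum k)))"
  have en_in: "enum k \<in> q" if "k < card q" for k using en that by (auto simp: bij_betw_def)
  have lu: "snd (enum k) = {lo k..up k} \<and> lo k \<le> up k \<and> a \<le> lo k \<and> up k \<le> b \<and> {lo k..up k} \<subseteq> U"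
    if k: "k < card q" for k
  proof -
    obtain x K where xK: "enum k = (x, K)" by (cases "enum k")
    then have "(x, K) \<in> p" "x \<in> N" using en_in[OF k] by (auto simp: q_def)
    with iv[of x K] xK show ?thesis by (auto simp: lo_def up_def g_def)
  qed
  have disj: "disjoint_family_on (\<lambda>k. {lo k<..<up k}) {..<card q}"
    unfolding disjoint_family_on_def
  proof (intro ballI impI)
    fix k l assume kl: "k \<in> {..<card q}" "l \<in> {..<card q}" "k \<noteq> l"
    then have ne: "enum k \<noteq> enum l" using en by (auto simp: bij_betw_def inj_on_def)
    obtain x K y M where xK: "enum k = (x, K)" "enum l = (y, M)" by (metis surj_pair)
    have "(x,K) \<in> p" "(y,M) \<in> p" using en_in kl qp xK by (metis lessThan_iff subsetD)+
    then have "interior K \<inter> interior M = {}"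
      using tagged_division_ofD(5)[OF p(1)] ne xK by auto
    moreover have "K = {lo k..up k}" "M = {lo l..up l}" using lu[of k] lu[of l] kl xK by simp_all
    ultimately show "{lo k<..<up k} \<inter> {lo l<..<up l} = {}" by simp
  qed
  have len: "(\<Sum>k<card q. up k - lo k) < \<delta>"
  proof -
    have "ennreal (\<Sum>k<card q. up k - lo k) = (\<Sum>k<card q. emeasure lborel {lo k<..<up k})"
      using lu by (subst sum_ennreal[symmetric]) auto
    also have "\<dots> = emeasure lborel (\<Union>k<card q. {lo k<..<up k})"
      by (rule sum_emeasure) (use disj in auto)
    also have "\<dots> \<le> emeasure lborel U"
    proof (rule emeasure_mono)
      show "(\<Union>k<card q. {lo k<..<up k}) \<subseteq> U"
      proof
        fix x assume "x \<in> (\<Union>k<card q. {lo k<..<up k})"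
        then obtain k where "k < card q" "lo k < x" "x < up k" by auto
        then show "x \<in> U" using lu[of k] by (auto simp: subset_iff)
      qed
    qed (use U in auto)
    also have "\<dots> < ennreal \<delta>" by (rule emU)
    finally have "ennreal (\<Sum>k<card q. up k - lo k) < ennreal \<delta>" .
    moreover have "0 \<le> (\<Sum>k<card q. up k - lo k)" by (rule sum_nonneg) (use lu in auto)
    ultimately show ?thesis by (simp add: ennreal_less_iff)
  qed
  have "\<forall>k<card q. lo k \<le> up k \<and> {lo k..up k} \<subseteq> I"
    using lu sub by fastforce
  from ac\<delta>[OF this disj len] have sumq: "(\<Sum>k<card q. \<bar>T (up k) - T (lo k)\<bar>) < e" .
  have sumq': "(\<Sum>k<card q. \<bar>T (up k) - T (lo k)\<bar>) = (\<Sum>xk\<in>q. \<bar>T (Sup (snd xk)) - T (Inf (snd xk))\<bar>)"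
    unfolding lo_def up_def
    using sum.reindex_bij_betw[OF en, of "\<lambda>xk. \<bar>T (Sup (snd xk)) - T (Inf (snd xk))\<bar>"] by simp
  have hq: "(\<Sum>xk\<in>q. h (Sup (snd xk)) - h (Inf (snd xk))) \<ge> - e"
  proof -
    have "(\<Sum>xk\<in>q. h (Sup (snd xk)) - h (Inf (snd xk))) \<ge> (\<Sum>xk\<in>q. - \<bar>T (Sup (snd xk)) - T (Inf (snd xk))\<bar>)"
    proof (rule sum_mono)
      fix xk assume "xk \<in> q"
      then obtain x K where xk: "xk = (x, K)" "(x, K) \<in> p" by (cases xk) (auto simp: q_def)
      obtain u v where "K = {u..v}" "u \<le> v" "a \<le> u" "v \<le> b" using iv[OF xk(2)] by blast
      then show "- \<bar>T (Sup (snd xk)) - T (Inf (snd xk))\<bar> \<le> h (Sup (snd xk)) - h (Inf (snd xk))"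
        using mono[of u v] xk by (simp add: h_def)
    qed
    moreover have "(\<Sum>xk\<in>q. - \<bar>T (Sup (snd xk)) - T (Inf (snd xk))\<bar>) > - e"
      using sumq sumq' by (simp add: sum_negf)
    ultimately show ?thesis by linarith
  qed
  have hp: "(\<Sum>xk\<in>p - q. h (Sup (snd xk)) - h (Inf (snd xk))) \<ge> - e * (b - a)"
  proof -
    have "(\<Sum>xk\<in>p - q. h (Sup (snd xk)) - h (Inf (snd xk))) \<ge> (\<Sum>xk\<in>p - q. - e * (Sup (snd xk) - Inf (snd xk)))"
    proof (rule sum_mono)
      fix xk assume "xk \<in> p - q"
      then obtain x K where xk: "xk = (x, K)" "(x, K) \<in> p" "x \<notin> N" by (cases xk) (auto simp: q_def)
      obtain u v where uv: "K = {u..v}" "u \<le> v" "a \<le> u" "v \<le> b" "u \<le> x" "x \<le> v" "{u..v} \<subseteq> g x"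
        using iv[OF xk(2)] by blast
      have "u \<in> ball x (d x)" "v \<in> ball x (d x)"
        using uv xk(3) unfolding g_def by (auto simp: subset_iff)
      then show "- e * (Sup (snd xk) - Inf (snd xk)) \<le> h (Sup (snd xk)) - h (Inf (snd xk))"
        using d'[of x u v] uv xk by simp
    qed
    moreover have "(\<Sum>xk\<in>p - q. - e * (Sup (snd xk) - Inf (snd xk))) \<ge> (\<Sum>xk\<in>p. - e * (Sup (snd xk) - Inf (snd xk)))"
    proof -
      have "(\<Sum>xk\<in>q. - e * (Sup (snd xk) - Inf (snd xk))) \<le> 0"
      proof (rule sum_nonpos)
        fix xk assume "xk \<in> q"
        then obtain x K where xk: "xk = (x, K)" "(x, K) \<in> p" by (cases xk) (auto simp: q_def)
        obtain u v where "K = {u..v}" "u \<le> v" using iv[OF xk(2)] by blast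
        then show "- e * (Sup (snd xk) - Inf (snd xk)) \<le> 0" using xk e by simp
      qed
      then show ?thesis using sum.subset_diff[OF qp(1) finp, of "\<lambda>xk. - e * (Sup (snd xk) - Inf (snd xk))"]
        by linarith
    qed
    moreover have "(\<Sum>xk\<in>p. - e * (Sup (snd xk) - Inf (snd xk))) = - e * (b - a)"
      using additive_tagged_division_1[OF ab p(1), of "\<lambda>x. - e * x"]
      by (simp add: case_prod_beta algebra_simps)
    ultimately show ?thesis by linarith
  qed
  have "h b - h a = (\<Sum>xk\<in>p. h (Sup (snd xk)) - h (Inf (snd xk)))"
    using additive_tagged_division_1[OF ab p(1), of h] by (simp add: case_prod_beta)
  also have "\<dots> = (\<Sum>xk\<in>p - q. h (Sup (snd xk)) - h (Inf (snd xk))) + (\<Sum>xk\<in>q. h (Sup (snd xk)) - h (Inf (snd xk)))"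
    by (rule sum.subset_diff[OF qp(1) finp])
  also have "\<dots> \<ge> - e * (b - a) - e" using hq hp by linarith
  finally have "h b - h a \<ge> - (e * (b - a + 1))" by (simp add: algebra_simps)
  also have "e * (b - a + 1) = e0" using ab by (simp add: e_def)
  finally show "T b - T a \<le> \<phi> b - \<phi> a + e0" by (simp add: h_def)
qed

lemma absolutely_continuous_on_uminus:
  "absolutely_continuous_on I T \<Longrightarrow> absolutely_continuous_on I (\<lambda>x. - T x)"
  unfolding absolutely_continuous_on_def by (simp add: abs_minus_commute)

lemma perturbed_lattice_mono:
  assumes "perturbed_lattice L T z" "0 \<le> a" "a \<le> b"
  shows "T a \<le> T b"
proof -
  have "AE r in lborel. 0 < r \<longrightarrow> (\<exists>D. (T has_real_derivative D) (at r) \<and> 0 \<le> D \<and> D \<le> 1 / r)"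
    using assms by (simp add: perturbed_lattice_def)
  then have "AE r in lborel. a < r \<and> r < b \<longrightarrow> (\<exists>D\<ge>0. ((\<lambda>x. 0 - - T x) has_real_derivative D) (at r))"
    by (rule AE_mp) (use assms in \<open>intro AE_I2; auto\<close>)
  from absolutely_continuous_increment_le[OF absolutely_continuous_on_uminus assms(3) _ _ this, of "{0..}"] assms
  show ?thesis by (simp add: perturbed_lattice_def)
qed

lemma perturbed_lattice_log_growth:
  assumes "perturbed_lattice L T z" "0 < a" "a \<le> b"
  shows "T b \<le> T a + ln (b / a)"
proof -
  have "AE r in lborel. 0 < r \<longrightarrow> (\<exists>D. (T has_real_derivative D) (at r) \<and> 0 \<le> D \<and> D \<le> 1 / r)"
    using assms by (simp add: perturbed_lattice_def)
  then have "AE r in lborel. a < r \<and> r < b \<longrightarrow> (\<exists>D\<ge>0. ((\<lambda>x. ln x - T x) has_real_derivative D) (at r))"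
  proof (rule AE_mp, intro AE_I2 impI)
    fix r assume "0 < r \<longrightarrow> (\<exists>D. (T has_real_derivative D) (at r) \<and> 0 \<le> D \<and> D \<le> 1 / r)" "a < r \<and> r < b"
    then obtain D where r: "r > 0" "(T has_real_derivative D) (at r)" "D \<le> 1 / r" using assms by auto
    then have "((\<lambda>x. ln x - T x) has_real_derivative (1 / r - D)) (at r)"
      by (auto intro!: derivative_eq_intros)
    then show "\<exists>D\<ge>0. ((\<lambda>x. ln x - T x) has_real_derivative D) (at r)"
      using r by (intro exI[of _ "1 / r - D"]) simp
  qed
  from absolutely_continuous_increment_le[OF _ assms(3) _ _ this, of "{0..}"] assms
  have "T b - T a \<le> ln b - ln a" by (auto simp: perturbed_lattice_def)
  then show ?thesis using assms by (simp add: ln_div)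
qed

text \<open>
The argument is \<open>1 + |u|\<close> and not \<open>|u|\<close> because the hypothesis \<open>T' \<le> 1/r\<close> allows \<open>T\<close> to
grow arbitrarily much on \<open>[0, 1]\<close>; after the shift, \<open>ln\<close> of the ratio of the two arguments is
controlled by the distance of the two points.
\<close>
lemma perturbed_lattice_slow_variation:
  assumes P: "perturbed_lattice L T z"
  shows "T (1 + cmod u) \<le> T (1 + cmod w) + ln (1 + cmod (u - w))"
proof (cases "cmod u \<le> cmod w")
  case True
  then have "T (1 + cmod u) \<le> T (1 + cmod w)" by (intro perturbed_lattice_mono[OF P]) auto
  moreover have "ln (1 + cmod (u - w)) \<ge> 0" by simp
  ultimately show ?thesis by linarith
next
  case False
  then have "T (1 + cmod u) \<le> T (1 + cmod w) + ln ((1 + cmod u) / (1 + cmod w))"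
    by (intro perturbed_lattice_log_growth[OF P]) (auto simp: add_pos_nonneg)
  moreover have "(1 + cmod u) / (1 + cmod w) \<le> 1 + cmod (u - w)"
  proof -
    have "cmod u \<le> cmod w + cmod (u - w)" using norm_triangle_ineq[of w "u - w"] by simp
    also have "\<dots> \<le> cmod w + cmod (u - w) + cmod w * cmod (u - w)" by simp
    finally have "1 + cmod u \<le> (1 + cmod (u - w)) * (1 + cmod w)" by (simp add: algebra_simps)
    then show ?thesis by (simp add: pos_divide_le_eq add_pos_nonneg)
  qed
  then have "ln ((1 + cmod u) / (1 + cmod w)) \<le> ln (1 + cmod (u - w))"
    by (subst ln_le_cancel_iff) (auto simp: add_pos_nonneg)
  ultimately show ?thesis by linarith
qed

section \<open>Interpolation in a disc\<close>

lemma holomorphic_factor_zeros: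
  assumes "finite A" "open S" "A \<subseteq> S" "F holomorphic_on S" "\<And>a. a \<in> A \<Longrightarrow> F a = 0"
  shows "\<exists>H. H holomorphic_on S \<and> (\<forall>z\<in>S. F z = (\<Prod>a\<in>A. z - a) * H z)"
  using assms(1,3,5)
proof (induction A rule: finite_induct)
  case empty
  then show ?case using assms(4) by auto
next
  case (insert a A)
  then obtain H where H: "H holomorphic_on S" "\<forall>z\<in>S. F z = (\<Prod>a\<in>A. z - a) * H z" by auto
  have "H a = 0"
    using H(2) insert.prems insert.hyps by (auto simp: prod_zero_iff)
  define H' where "H' = (\<lambda>z. if z = a then deriv H a else (H z - H a) / (z - a))"
  have "H' holomorphic_on S" unfolding H'_def by (rule pole_lemma_open[OF H(1) assms(2)])
  moreover have "H z = (z - a) * H' z" for z using \<open>H a = 0\<close> by (auto simp: H'_def)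
  ultimately show ?case using H(2) insert.hyps by (intro exI[of _ H']) (auto simp: mult_ac)
qed

text \<open>
Cauchy's integral formula at the centre, in a form that keeps the mean over the circle: a mean,
unlike a supremum, can later be integrated over all centres.
\<close>
lemma norm_center_le_circle_mean:
  assumes "open S" "cball 0 R \<subseteq> S" "R > 0" "K holomorphic_on S"
  shows "cmod (K 0) \<le> integral {0..1} (\<lambda>t. cmod (K (circlepath 0 R t)))"
proof -
  have cont: "continuous_on {0..1} (\<lambda>t. K (circlepath 0 R t))"
  proof (rule continuous_on_compose2[OF holomorphic_on_imp_continuous_on[OF assms(4)]])
    show "continuous_on {0..1} (circlepath 0 R)" by (simp add: circlepath_def part_circlepath_def continuous_intros)
    show "circlepath 0 R ` {0..1} \<subseteq> S"
      using assms(2,3) by (auto simp: circlepath norm_mult subset_iff)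
  qed
  have "((\<lambda>u. K u / (u - 0)) has_contour_integral (2 * of_real pi * \<i> * K 0)) (circlepath 0 R)"
  proof (rule Cauchy_integral_circlepath)
    show "continuous_on (cball 0 R) K"
      using holomorphic_on_imp_continuous_on[OF assms(4)] assms(2) continuous_on_subset by blast
    show "K holomorphic_on ball 0 R"
      by (rule holomorphic_on_subset[OF assms(4)]) (use assms(2) ball_subset_cball in blast)
  qed (use assms(3) in auto)
  then have "((\<lambda>t. K (circlepath 0 R t) / circlepath 0 R t * vector_derivative (circlepath 0 R) (at t within {0..1}))
      has_integral (2 * of_real pi * \<i> * K 0)) {0..1}"
    by (simp add: has_contour_integral_def)
  then have "((\<lambda>t. (2 * of_real pi * \<i>) * K (circlepath 0 R t)) has_integral (2 * of_real pi * \<i> * K 0)) {0..1}"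
  proof (rule has_integral_eq[rotated])
    fix t :: real assume t: "t \<in> {0..1}"
    then have vd: "vector_derivative (circlepath 0 R) (at t within {0..1}) =
        2 * pi * \<i> * R * exp (2 * of_real pi * \<i> * t)"
      using vector_derivative_circlepath01[of t 0 R] by simp
    have "circlepath 0 R t = R * exp (2 * of_real pi * \<i> * t)" by (simp add: circlepath)
    then show "K (circlepath 0 R t) / circlepath 0 R t * vector_derivative (circlepath 0 R) (at t within {0..1}) =
        (2 * of_real pi * \<i>) * K (circlepath 0 R t)"
      unfolding vd using assms(3) by simp
  qed
  from has_integral_mult_right[OF this, of "1 / (2 * of_real pi * \<i>)"]
  have "((\<lambda>t. K (circlepath 0 R t)) has_integral K 0) {0..1}" by simp
  then have "K 0 = integral {0..1} (\<lambda>t. K (circlepath 0 R t))" by (simp add: integral_unique)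
  also have "norm \<dots> \<le> integral {0..1} (\<lambda>t. cmod (K (circlepath 0 R t)))"
    by (rule integral_norm_bound_integral)
      (use cont in \<open>auto intro!: integrable_continuous_real continuous_intros\<close>)
  finally show ?thesis .
qed

text \<open>
Let \<open>b\<^sub>a\<close> be the Blaschke factor of the disc with zero \<open>a\<close>, and \<open>G\<close> the combination
\<open>\<Sum> F(a) \<Prod> b\<^sub>c(z) / b\<^sub>c(a)\<close> that interpolates \<open>F\<close> on \<open>A\<close>.  Then \<open>F - G\<close> is divisible by the
product \<open>\<Prod> b\<^sub>a\<close>, which has modulus \<open>1\<close> on the circle and \<open>\<Prod> |a| / R\<close> at the centre; the mean value
inequality is applied to the quotient.  The interpolant contributes once at the centre and once
on the circle, whence the factor \<open>2\<close>.
\<close>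
lemma interpolation_bound:
  fixes F :: "complex \<Rightarrow> complex"
  assumes A: "finite A" "A \<subseteq> ball 0 R" and R: "R > 0" and F: "F holomorphic_on UNIV"
  shows "cmod (F 0) \<le> (\<Prod>a\<in>A. cmod a / R) * integral {0..1} (\<lambda>t. cmod (F (circlepath 0 R t)))
           + 2 * (\<Sum>a\<in>A. cmod (F a) * (\<Prod>c\<in>A-{a}. 2 * R / cmod (a - c)))"
proof -
  define b where "b = (\<lambda>c z. of_real R * (z - c) / (of_real (R\<^sup>2) - cnj c * z))"
  define S where "S = {z. \<forall>a\<in>A. of_real (R\<^sup>2) - cnj a * z \<noteq> 0}"
  define G where "G = (\<lambda>z. \<Sum>a\<in>A. F a * (\<Prod>c\<in>A-{a}. b c z / b c a))"
  define g where "g = (\<Sum>a\<in>A. cmod (F a) * (\<Prod>c\<in>A-{a}. 2 * R / cmod (a - c)))"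
  have normA: "cmod a < R" if "a \<in> A" for a using A(2) that by auto
  have nz: "of_real (R\<^sup>2) - cnj a * z \<noteq> 0" if "a \<in> A" "cmod z \<le> R" for a z
  proof
    assume "of_real (R\<^sup>2) - cnj a * z = 0"
    then have "cmod (of_real (R\<^sup>2)) = cmod (cnj a * z)" by simp
    then have "R * R = cmod a * cmod z" by (simp add: norm_mult power2_eq_square)
    moreover have "cmod a * cmod z < R * R"
      using mult_left_mono[OF that(2), of "cmod a"] mult_strict_right_mono[OF normA[OF that(1)] R]
      by simp
    ultimately show False by simp
  qed
  have "S = (\<Inter>a\<in>A. {z. of_real (R\<^sup>2) - cnj a * z \<noteq> 0})" by (auto simp: S_def)
  also have "open \<dots>" using A(1)
    by (intro open_INT) (auto intro!: open_Collect_neq continuous_intros)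
  finally have S: "open S" .
  have subS: "cball 0 R \<subseteq> S" unfolding S_def using nz by (force simp del: of_real_power)
  have AS: "A \<subseteq> S" using A(2) subS ball_subset_cball by blast
  have bhol: "b c holomorphic_on S" if "c \<in> A" for c
    unfolding b_def using that by (auto simp: S_def intro!: holomorphic_intros)
  have bnz: "b c a \<noteq> 0" if "c \<in> A" "a \<in> A" "a \<noteq> c" for a c
    using nz[of c a] normA[of a] that R by (auto simp: b_def)
  have ble: "cmod (1 / b c a) \<le> 2 * R / cmod (a - c)" if "c \<in> A" "a \<in> A" "a \<noteq> c" for a c
  proof -
    have "cmod (of_real (R\<^sup>2) - cnj c * a) \<le> R * R + cmod c * cmod a"
      using norm_triangle_ineq4[of "of_real (R\<^sup>2)" "cnj c * a"] by (simp add: norm_mult power2_eq_square)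
    also have "cmod c * cmod a \<le> R * R"
      using normA[OF that(1)] normA[OF that(2)] R by (intro mult_mono) auto
    finally have *: "cmod (of_real (R\<^sup>2) - cnj c * a) \<le> 2 * R * R" by simp
    have "cmod (1 / b c a) = cmod (of_real (R\<^sup>2) - cnj c * a) / (R * cmod (a - c))"
      using R by (simp add: b_def norm_divide norm_mult)
    also have "\<dots> \<le> (2 * R * R) / (R * cmod (a - c))"
      by (rule divide_right_mono[OF *]) (use R in auto)
    finally show ?thesis using R by simp
  qed
  have b1: "cmod (b c z) = 1" if "c \<in> A" "cmod z = R" for c z
  proof -
    have "of_real (R\<^sup>2) = z * cnj z" using that(2) by (metis complex_norm_square)
    then have "of_real (R\<^sup>2) - cnj c * z = z * cnj (z - c)" by (simp add: algebra_simps)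
    then have "cmod (of_real (R\<^sup>2) - cnj c * z) = R * cmod (z - c)"
      using that(2) by (metis complex_mod_cnj norm_mult)
    moreover have "z \<noteq> c" using normA that by auto
    ultimately show ?thesis using R by (simp add: b_def norm_divide norm_mult)
  qed
  have b0: "cmod (b c 0) \<le> 1" if "c \<in> A" for c
    using normA[OF that] R by (simp add: b_def norm_divide norm_mult power2_eq_square)
  have Gle: "cmod (G z) \<le> g" if "\<And>c. c \<in> A \<Longrightarrow> cmod (b c z) \<le> 1" for z
  proof -
    have "cmod (G z) \<le> (\<Sum>a\<in>A. cmod (F a * (\<Prod>c\<in>A-{a}. b c z / b c a)))"
      unfolding G_def by (rule norm_sum)
    also have "\<dots> \<le> g"
      unfolding g_def
    proof (rule sum_mono)
      fix a assume a: "a \<in> A"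
      have "cmod (\<Prod>c\<in>A-{a}. b c z / b c a) = (\<Prod>c\<in>A-{a}. cmod (b c z) * cmod (1 / b c a))"
        by (simp add: prod_norm[symmetric] norm_divide)
      also have "\<dots> \<le> (\<Prod>c\<in>A-{a}. 2 * R / cmod (a - c))"
      proof (rule prod_mono)
        fix c assume c: "c \<in> A - {a}"
        have "cmod (b c z) * cmod (1 / b c a) \<le> 1 * (2 * R / cmod (a - c))"
          using that[of c] ble[of c a] a c by (intro mult_mono) auto
        then show "0 \<le> cmod (b c z) * cmod (1 / b c a) \<and> cmod (b c z) * cmod (1 / b c a) \<le> 2 * R / cmod (a - c)"
          by simp
      qed
      finally show "cmod (F a * (\<Prod>c\<in>A-{a}. b c z / b c a)) \<le> cmod (F a) * (\<Prod>c\<in>A-{a}. 2 * R / cmod (a - c))"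
        by (simp add: norm_mult mult_left_mono)
    qed
    finally show ?thesis .
  qed
  have Ghol: "G holomorphic_on S"
    unfolding G_def
    by (intro holomorphic_intros bhol) (use bnz in auto)
  have GA: "G a = F a" if a: "a \<in> A" for a
  proof -
    have "G a = (\<Sum>x\<in>A. if x = a then F a else 0)"
      unfolding G_def
    proof (rule sum.cong)
      fix x assume x: "x \<in> A"
      show "F x * (\<Prod>c\<in>A-{x}. b c a / b c x) = (if x = a then F a else 0)"
      proof (cases "x = a")
        case True
        have "(\<Prod>c\<in>A-{a}. b c a / b c a) = 1"
          by (rule prod.neutral) (use bnz a in auto)
        then show ?thesis using True by simp
      next
        case False
        have "(\<Prod>c\<in>A-{x}. b c a / b c x) = 0"
          using False a A(1) by (intro prod_zero) (auto simp: b_def intro!: bexI[of _ a])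
        then show ?thesis using False by simp
      qed
    qed simp
    then show ?thesis using a A(1) by simp
  qed
  have FGhol: "(\<lambda>z. F z - G z) holomorphic_on S"
    using F Ghol by (intro holomorphic_intros) (auto intro: holomorphic_on_subset)
  obtain H where H: "H holomorphic_on S" "\<forall>z\<in>S. F z - G z = (\<Prod>a\<in>A. z - a) * H z"
    using holomorphic_factor_zeros[OF A(1) S AS FGhol] GA by auto
  \<comment> \<open>The quotient of \<open>F - G\<close> by the product of the Blaschke factors, with the removable singularities removed.\<close>
  define K where "K = (\<lambda>z. H z * (\<Prod>a\<in>A. (of_real (R\<^sup>2) - cnj a * z) / of_real R))"
  have Khol: "K holomorphic_on S" unfolding K_def using H R by (intro holomorphic_intros) auto
  have circ: "cmod (circlepath 0 R t) = R" for t using R by (simp add: circlepath norm_mult)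
  have Kcirc: "cmod (K z) \<le> cmod (F z) + g" if z: "cmod z = R" for z
  proof -
    have zS: "z \<in> S" using subS z by auto
    have "K z * (\<Prod>a\<in>A. b a z) = H z * (\<Prod>a\<in>A. (of_real (R\<^sup>2) - cnj a * z) / of_real R * b a z)"
      unfolding K_def prod.distrib by (simp only: mult.assoc)
    also have "(\<Prod>a\<in>A. (of_real (R\<^sup>2) - cnj a * z) / of_real R * b a z) = (\<Prod>a\<in>A. z - a)"
    proof (rule prod.cong)
      fix a assume "a \<in> A"
      then show "(of_real (R\<^sup>2) - cnj a * z) / of_real R * b a z = z - a"
        using nz[of a z] z R by (simp add: b_def)
    qed simp
    finally have "K z * (\<Prod>a\<in>A. b a z) = F z - G z" using H(2) zS by (simp add: mult_ac)
    moreover have "cmod (\<Prod>a\<in>A. b a z) = 1"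
      unfolding prod_norm[symmetric] by (rule prod.neutral) (use b1 z in auto)
    ultimately have "cmod (K z) = cmod (F z - G z)" by (metis mult.right_neutral norm_mult)
    also have "\<dots> \<le> cmod (F z) + cmod (G z)" by (rule norm_triangle_ineq4)
    also have "cmod (G z) \<le> g" by (rule Gle) (use b1 z in auto)
    finally show ?thesis by simp
  qed
  have cp: "continuous_on {0..1} (circlepath 0 R)"
    by (simp add: circlepath_def part_circlepath_def continuous_intros)
  have contF: "continuous_on {0..1} (\<lambda>t. F (circlepath 0 R t))"
    by (rule continuous_on_compose2[OF holomorphic_on_imp_continuous_on[OF F] cp]) auto
  have contK: "continuous_on {0..1} (\<lambda>t. K (circlepath 0 R t))"
    by (rule continuous_on_compose2[OF holomorphic_on_imp_continuous_on[OF Khol] cp])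
      (use subS circ in auto)
  have g0: "g \<ge> 0" unfolding g_def using R by (intro sum_nonneg mult_nonneg_nonneg prod_nonneg) auto
  let ?I = "integral {0..1} (\<lambda>t. cmod (F (circlepath 0 R t)))"
  let ?P = "\<Prod>a\<in>A. cmod a / R"
  have "cmod (K 0) \<le> integral {0..1} (\<lambda>t. cmod (K (circlepath 0 R t)))"
    by (rule norm_center_le_circle_mean[OF S subS R Khol])
  also have "\<dots> \<le> integral {0..1} (\<lambda>t. cmod (F (circlepath 0 R t)) + g)"
    by (rule integral_le) (use contF contK Kcirc circ in \<open>auto intro!: integrable_continuous_real continuous_intros\<close>)
  also have "\<dots> = ?I + g"
    by (subst integral_add) (use contF in \<open>auto intro!: integrable_continuous_real continuous_intros\<close>)
  finally have K0: "cmod (K 0) \<le> ?I + g" .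
  have P: "0 \<le> ?P" "?P \<le> 1"
    using R normA by (auto intro!: prod_nonneg prod_le_1 simp: less_imp_le)
  have "(0::complex) \<in> S" using subS R by (force simp: subset_iff)
  then have "F 0 - G 0 = (\<Prod>a\<in>A. 0 - a) * H 0" by (rule H(2)[rule_format])
  also have "\<dots> = (\<Prod>a\<in>A. - a / of_real R) * K 0"
  proof -
    have "(\<Prod>a\<in>A. - a / of_real R) * (\<Prod>a\<in>A. (of_real (R\<^sup>2) - cnj a * 0) / of_real R) = (\<Prod>a\<in>A. 0 - a)"
      unfolding prod.distrib[symmetric] using R by (intro prod.cong) (auto simp: power2_eq_square)
    then show ?thesis unfolding K_def by (metis mult.assoc mult.commute)
  qed
  finally have "cmod (F 0 - G 0) = ?P * cmod (K 0)"
    using R by (simp add: norm_mult prod_norm[symmetric] norm_divide)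
  also have "\<dots> \<le> ?P * (?I + g)" by (rule mult_left_mono[OF K0 P(1)])
  also have "\<dots> \<le> ?P * ?I + g" using P g0 mult_right_mono[of ?P 1 g] by (simp add: algebra_simps)
  finally have "cmod (F 0 - G 0) \<le> ?P * ?I + g" .
  moreover have "cmod (G 0) \<le> g" by (rule Gle) (rule b0)
  moreover have "cmod (F 0) \<le> cmod (F 0 - G 0) + cmod (G 0)"
    using norm_triangle_ineq[of "F 0 - G 0" "G 0"] by simp
  ultimately show ?thesis unfolding g_def by linarith
qed

section \<open>Counting lattice points and their perturbations\<close>

lemma lattice_point_simps [simp]:
  "Re (lattice_point L (m, n)) = sqrt (pi / L) * of_int m"
  "Im (lattice_point L (m, n)) = sqrt (pi / L) * of_int n"
  by (simp_all add: lattice_point_def)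

lemma card_int_interval_le:
  assumes "(h::real) > 0" "r \<ge> 0"
  shows "finite {m::int. \<bar>h * of_int m - x\<bar> \<le> r} \<and> real (card {m::int. \<bar>h * of_int m - x\<bar> \<le> r}) \<le> 2 * r / h + 1"
proof -
  have "\<bar>h * of_int m - x\<bar> \<le> r \<longleftrightarrow> \<lceil>(x - r) / h\<rceil> \<le> m \<and> m \<le> \<lfloor>(x + r) / h\<rfloor>" for m :: int
  proof -
    have a: "(x - r) / h \<le> of_int m \<longleftrightarrow> x - r \<le> h * of_int m"
      using pos_divide_le_eq[OF assms(1)] by (simp add: mult.commute)
    have b: "of_int m \<le> (x + r) / h \<longleftrightarrow> h * of_int m \<le> x + r"
      using pos_le_divide_eq[OF assms(1)] by (simp add: mult.commute)
    show ?thesis unfolding ceiling_le_iff le_floor_iff a b abs_le_iff by (intro iffI conjI; linarith)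
  qed
  then have eq: "{m::int. \<bar>h * of_int m - x\<bar> \<le> r} = {\<lceil>(x - r) / h\<rceil>..\<lfloor>(x + r) / h\<rfloor>}"
    unfolding set_eq_iff mem_Collect_eq atLeastAtMost_iff by blast
  have "real (card {\<lceil>(x - r) / h\<rceil>..\<lfloor>(x + r) / h\<rfloor>}) \<le> 2 * r / h + 1"
  proof -
    have "real_of_int (\<lfloor>(x + r) / h\<rfloor> - \<lceil>(x - r) / h\<rceil> + 1) \<le> (x + r) / h - (x - r) / h + 1"
      by (simp; linarith)
    also have "\<dots> = 2 * r / h + 1" by (simp add: diff_divide_distrib add_divide_distrib)
    finally have "real_of_int (\<lfloor>(x + r) / h\<rfloor> - \<lceil>(x - r) / h\<rceil> + 1) \<le> 2 * r / h + 1" .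
    moreover have "real (nat k) \<le> y" if "real_of_int k \<le> y" "0 \<le> y" for k y
      using that by (cases "k \<ge> 0") auto
    moreover have "0 \<le> 2 * r / h + 1" using assms by simp
    ultimately show ?thesis unfolding card_atLeastAtMost_int by blast
  qed
  then show ?thesis unfolding eq by (intro conjI finite_atLeastAtMost_int)
qed

lemma card_lattice_le:
  assumes L: "L \<ge> 1" and r: "r \<ge> 1"
  shows "finite {i. cmod (lattice_point L i - w) \<le> r} \<and>
         real (card {i. cmod (lattice_point L i - w) \<le> r}) \<le> 9 * L * r\<^sup>2"
proof -
  define h where "h = sqrt (pi / L)"
  have h: "h > 0" using L by (simp add: h_def)
  let ?A = "\<lambda>x. {m::int. \<bar>h * of_int m - x\<bar> \<le> r}"
  have sub: "{i. cmod (lattice_point L i - w) \<le> r} \<subseteq> ?A (Re w) \<times> ?A (Im w)"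
  proof clarify
    fix m n assume *: "cmod (lattice_point L (m, n) - w) \<le> r"
    then show "m \<in> ?A (Re w) \<and> n \<in> ?A (Im w)"
      using abs_Re_le_cmod[of "lattice_point L (m, n) - w"] abs_Im_le_cmod[of "lattice_point L (m, n) - w"]
      by (simp add: h_def)
  qed
  have A: "finite (?A x)" "real (card (?A x)) \<le> 2 * r / h + 1" for x
    using card_int_interval_le[OF h, of r x] r by auto
  have "1 / h = sqrt (L / pi)" unfolding h_def by (simp add: real_sqrt_divide)
  also have "\<dots> \<le> sqrt L" using L pi_gt3 by (intro real_sqrt_le_mono) (simp add: divide_le_eq)
  finally have "2 * r / h \<le> 2 * r * sqrt L" using r mult_left_mono[of "1/h" "sqrt L" "2*r"] by simp
  moreover have "1 \<le> r * sqrt L" using r L mult_mono[of 1 r 1 "sqrt L"] by simp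
  ultimately have b: "2 * r / h + 1 \<le> 3 * (r * sqrt L)" by simp
  have "card {i. cmod (lattice_point L i - w) \<le> r} \<le> card (?A (Re w)) * card (?A (Im w))"
  proof -
    have "card {i. cmod (lattice_point L i - w) \<le> r} \<le> card (?A (Re w) \<times> ?A (Im w))"
      by (rule card_mono[OF _ sub]) (intro finite_cartesian_product A(1))
    also have "\<dots> = card (?A (Re w)) * card (?A (Im w))" by (rule card_cartesian_product)
    finally show ?thesis .
  qed
  then have "real (card {i. cmod (lattice_point L i - w) \<le> r}) \<le> real (card (?A (Re w))) * real (card (?A (Im w)))"
    by (metis of_nat_le_iff of_nat_mult)
  also have "\<dots> \<le> (3 * (r * sqrt L)) * (3 * (r * sqrt L))"
    by (intro mult_mono order_trans[OF A(2) b]) (use r L in auto)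
  also have "\<dots> = 9 * L * r\<^sup>2" using L by (simp add: power2_eq_square)
  finally have "real (card {i. cmod (lattice_point L i - w) \<le> r}) \<le> 9 * L * r\<^sup>2" .
  moreover have "finite {i. cmod (lattice_point L i - w) \<le> r}"
    by (rule finite_subset[OF sub]) (intro finite_cartesian_product A(1))
  ultimately show ?thesis by simp
qed

text \<open>
Closed squares of area \<open>\<pi>/L\<close> around the lattice points in the larger disc cover the smaller disc:
each point is within one side length, which is less than \<open>2\<close>, of its nearest lattice point.
\<close>
lemma card_lattice_ge:
  assumes L: "L \<ge> 1" and r: "r \<ge> 0"
  shows "L * r\<^sup>2 \<le> real (card {i. lattice_point L i \<in> ball w (r + 2)})"
proof -
  define h where "h = sqrt (pi / L)"
  define N where "N = {i. lattice_point L i \<in> ball w (r + 2)}"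
  define Q where "Q = (\<lambda>i. cbox (lattice_point L i - Complex (h/2) (h/2)) (lattice_point L i + Complex (h/2) (h/2)))"
  have h: "h > 0" using L by (simp add: h_def)
  have "pi / L \<le> 4" using L pi_less_4 by (simp add: divide_le_eq)
  then have h2: "h \<le> 2" unfolding h_def using real_sqrt_le_mono[of "pi/L" 4] by simp
  have "N \<subseteq> {i. cmod (lattice_point L i - w) \<le> r + 2}"
    by (auto simp: N_def dist_norm norm_minus_commute)
  then have fin: "finite N" using card_lattice_le[OF L, of "r + 2" w] r finite_subset by auto
  have cov: "ball w r \<subseteq> (\<Union>i\<in>N. Q i)"
  proof
    fix x assume x: "x \<in> ball w r"
    define i where "i = (round (Re x / h), round (Im x / h))"
    have rd: "\<bar>h * of_int (round (y / h)) - y\<bar> \<le> h / 2" for y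
    proof -
      have "\<bar>of_int (round (y / h)) - y / h\<bar> \<le> 1 / 2" by (rule of_int_round_abs_le)
      then have "h * \<bar>of_int (round (y / h)) - y / h\<bar> \<le> h * (1 / 2)" using h by (intro mult_left_mono) auto
      moreover have "h * \<bar>of_int (round (y / h)) - y / h\<bar> = \<bar>h * of_int (round (y / h)) - y\<bar>"
        using h by (simp add: abs_mult_pos' right_diff_distrib)
      ultimately show ?thesis by simp
    qed
    have Re: "\<bar>Re (lattice_point L i - x)\<bar> \<le> h / 2" and Im: "\<bar>Im (lattice_point L i - x)\<bar> \<le> h / 2"
      using rd[of "Re x"] rd[of "Im x"] by (simp_all add: i_def h_def[symmetric])
    have "cmod (lattice_point L i - x) \<le> h" using cmod_le[of "lattice_point L i - x"] Re Im by linarith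
    moreover have "dist w (lattice_point L i) \<le> dist w x + cmod (lattice_point L i - x)"
      using dist_triangle[of w "lattice_point L i" x] by (simp add: dist_norm norm_minus_commute)
    ultimately have "i \<in> N" using x h2 by (simp add: N_def)
    moreover have "x \<in> Q i"
      using Re Im unfolding Q_def in_cbox_complex_iff abs_le_iff by simp
    ultimately show "x \<in> (\<Union>i\<in>N. Q i)" by blast
  qed
  have emQ: "emeasure lborel (Q i) = ennreal (h\<^sup>2)" for i
    unfolding Q_def
    by (subst emeasure_lborel_cbox) (use h in \<open>auto simp: Basis_complex_def power2_eq_square\<close>)
  have "ennreal (pi * r\<^sup>2) = emeasure lborel (ball w r)"
    using r by (simp add: emeasure_ball unit_ball_vol_2)
  also have "\<dots> \<le> emeasure lborel (\<Union>i\<in>N. Q i)"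
    by (rule emeasure_mono[OF cov]) (use fin in \<open>auto simp: Q_def intro!: sets.finite_UN\<close>)
  also have "\<dots> \<le> (\<Sum>i\<in>N. emeasure lborel (Q i))"
    by (rule emeasure_subadditive_finite) (use fin in \<open>auto simp: Q_def\<close>)
  also have "\<dots> = ennreal (real (card N) * h\<^sup>2)"
    by (simp add: emQ ennreal_mult ennreal_of_nat_eq_real_of_nat)
  finally have "pi * r\<^sup>2 \<le> real (card N) * h\<^sup>2" by (simp add: ennreal_le_iff)
  then have "L * (pi * r\<^sup>2) \<le> L * (real (card N) * (pi / L))"
    using L by (intro mult_left_mono) (auto simp: h_def)
  then have "pi * (L * r\<^sup>2) \<le> pi * real (card N)" using L by (simp add: mult_ac)
  then show ?thesis by (simp add: N_def)
qed

lemma ln_le_half: "y > 0 \<Longrightarrow> ln (y::real) \<le> y / 2"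
proof -
  assume y: "y > 0"
  have "ln y = ln (y / 2) + ln 2" using y by (simp add: ln_div)
  moreover have "ln (y / 2) \<le> y / 2 - 1" using y by (intro ln_le_minus_one) auto
  moreover have "ln (2::real) \<le> 1" using ln_le_minus_one[of "2::real"] by simp
  ultimately show ?thesis by linarith
qed

lemma perturbed_lattice_displacement:
  assumes "perturbed_lattice L T z"
  shows "cmod (z i - lattice_point L i) \<le> T (1 + cmod w) + ln (1 + cmod (lattice_point L i - w))"
proof -
  have "cmod (z i - lattice_point L i) \<le> T (cmod (lattice_point L i))"
    using assms unfolding perturbed_lattice_def by blast
  also have "\<dots> \<le> T (1 + cmod (lattice_point L i))" by (rule perturbed_lattice_mono[OF assms]) auto
  also have "\<dots> \<le> T (1 + cmod w) + ln (1 + cmod (lattice_point L i - w))"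
    by (rule perturbed_lattice_slow_variation[OF assms])
  finally show ?thesis .
qed

text \<open>
If \<open>x\<close> is the distance of \<open>\<lambda>\<^sub>i\<close> from \<open>w\<close>, the displacement is at most \<open>R + ln (1 + x)\<close>, and
\<open>ln (1 + x) \<le> (1 + x)/2\<close> can be absorbed; hence \<open>\<lambda>\<^sub>i\<close> lies in the disc of radius \<open>5 R\<close>.
\<close>
lemma card_perturbed_le:
  assumes P: "perturbed_lattice L T z" and L: "L \<ge> 1" and R: "R \<ge> 1" "T (1 + cmod w) \<le> R"
  shows "finite {i. z i \<in> ball w R} \<and> real (card {i. z i \<in> ball w R}) \<le> 225 * L * R\<^sup>2"
proof -
  have sub: "{i. z i \<in> ball w R} \<subseteq> {i. cmod (lattice_point L i - w) \<le> 5 * R}"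
  proof safe
    fix i assume i: "z i \<in> ball w R"
    define x where "x = cmod (lattice_point L i - w)"
    have "x \<le> dist w (z i) + cmod (z i - lattice_point L i)"
      unfolding x_def using norm_triangle_ineq4[of "z i - w" "z i - lattice_point L i"]
      by (simp add: dist_norm norm_minus_commute algebra_simps)
    also have "\<dots> \<le> R + (T (1 + cmod w) + ln (1 + x))"
      using perturbed_lattice_displacement[OF P, of i w] i unfolding x_def by simp
    finally have "x \<le> R + (T (1 + cmod w) + ln (1 + x))" .
    moreover have "ln (1 + x) \<le> (1 + x) / 2" by (rule ln_le_half) (simp add: x_def add_pos_nonneg)
    moreover have "T (1 + cmod w) \<le> R" "1 \<le> R" by (rule R)+
    moreover have "y \<le> R + (t + l) \<Longrightarrow> l \<le> (1 + y) / 2 \<Longrightarrow> t \<le> R \<Longrightarrow> 1 \<le> R \<Longrightarrow> y \<le> 5 * R" for y t l :: real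
      by (simp add: field_simps)
    ultimately have "x \<le> 5 * R" by blast
    then show "cmod (lattice_point L i - w) \<le> 5 * R" unfolding x_def .
  qed
  have c: "finite {i. cmod (lattice_point L i - w) \<le> 5 * R}"
     "real (card {i. cmod (lattice_point L i - w) \<le> 5 * R}) \<le> 9 * L * (5 * R)\<^sup>2"
    using card_lattice_le[OF L, of "5 * R" w] R by auto
  have "real (card {i. z i \<in> ball w R}) \<le> real (card {i. cmod (lattice_point L i - w) \<le> 5 * R})"
    using card_mono[OF c(1) sub] by simp
  also note c(2)
  finally show ?thesis using finite_subset[OF sub c(1)] by (simp add: power_mult_distrib)
qed

lemma finite_perturbed_ball:
  assumes P: "perturbed_lattice L T z" and L: "L \<ge> 1"
  shows "finite {i. z i \<in> ball w r}"
proof (rule finite_subset)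
  show "{i. z i \<in> ball w r} \<subseteq> {i. z i \<in> ball w (max (max 1 r) (T (1 + cmod w)))}" by auto
  show "finite {i. z i \<in> ball w (max (max 1 r) (T (1 + cmod w)))}"
    using card_perturbed_le[OF P L, of "max (max 1 r) (T (1 + cmod w))" w] by simp
qed

text \<open>
The number \<open>s\<close> bounds the displacement of every lattice point within distance \<open>R\<close> of \<open>w\<close>, plus the
loss \<open>2\<close> in the count of lattice points.
\<close>
lemma card_perturbed_ge:
  assumes P: "perturbed_lattice L T z" and L: "L \<ge> 1"
    and R: "R \<ge> 0" and s: "s = T (1 + cmod w) + ln (1 + R) + 2" and r: "s \<le> r" "r \<le> R"
  shows "L * (r - s)\<^sup>2 \<le> real (card {i. z i \<in> ball w r})"
proof -
  have T1: "T (1 + cmod w) \<ge> 1" using P by (simp add: perturbed_lattice_def)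
  have s2: "s \<ge> 2" using s T1 R by (simp add: add_increasing)
  have "L * (r - s)\<^sup>2 \<le> real (card {i. lattice_point L i \<in> ball w (r - s + 2)})"
    by (rule card_lattice_ge[OF L]) (use r in auto)
  also have "\<dots> \<le> real (card {i. z i \<in> ball w r})"
  proof -
    have "{i. lattice_point L i \<in> ball w (r - s + 2)} \<subseteq> {i. z i \<in> ball w r}"
    proof safe
      fix i assume i: "lattice_point L i \<in> ball w (r - s + 2)"
      then have x: "cmod (lattice_point L i - w) < r - s + 2" by (simp add: dist_norm norm_minus_commute)
      then have "ln (1 + cmod (lattice_point L i - w)) \<le> ln (1 + R)"
        using s2 r by (subst ln_le_cancel_iff) (auto simp: add_pos_nonneg)
      moreover have "dist w (z i) \<le> cmod (lattice_point L i - w) + cmod (z i - lattice_point L i)"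
        using norm_triangle_ineq[of "z i - lattice_point L i" "lattice_point L i - w"]
        by (simp add: dist_norm norm_minus_commute algebra_simps)
      ultimately show "z i \<in> ball w r"
        using perturbed_lattice_displacement[OF P, of i w] x s by simp
    qed
    then show ?thesis using finite_perturbed_ball[OF P L] by (simp add: card_mono)
  qed
  finally show ?thesis .
qed

definition well_separated :: "(real \<Rightarrow> real) \<Rightarrow> (int \<times> int \<Rightarrow> complex) \<Rightarrow> int \<times> int \<Rightarrow> bool"
  where "well_separated S z i \<longleftrightarrow> S (cmod (z i)) < product_separation z i"

lemma card_well_separated_ge:
  assumes P: "perturbed_lattice L T z" and sep: "separation_condition \<beta> T S z" and L: "L \<ge> 1"
    and R: "R \<ge> 0" and s: "s = T (1 + cmod w) + ln (1 + R) + 2" and r: "s \<le> r" "r \<le> R"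
  shows "L * (r - s)\<^sup>2 - \<beta> * (r\<^sup>2 / (log_star r)\<^sup>2) \<le> real (card {i. z i \<in> ball w r \<and> well_separated S z i})"
proof -
  have "T (cmod w) \<le> T (1 + cmod w)" by (rule perturbed_lattice_mono[OF P]) auto
  also have "\<dots> \<le> r" using r s ln_ge_zero[of "1 + R"] R by linarith
  finally have Tr: "T (cmod w) \<le> r" .
  let ?A = "{i. z i \<in> ball w r}" and ?G = "{i. z i \<in> ball w r \<and> well_separated S z i}"
    and ?B = "{i. z i \<in> ball w r \<and> product_separation z i \<le> S (cmod (z i))}"
  have "L * (r - s)\<^sup>2 \<le> real (card ?A)"
    by (rule card_perturbed_ge[OF P L R s r])
  moreover have "card ?A \<le> card ?G + card ?B"
  proof -
    have "?A = ?G \<union> ?B"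
      by (simp only: set_eq_iff mem_Collect_eq Un_iff well_separated_def not_le[symmetric]) blast
    then have "card ?A = card (?G \<union> ?B)" by (rule arg_cong)
    also have "\<dots> \<le> card ?G + card ?B" by (rule card_Un_le)
    finally show ?thesis .
  qed
  moreover have "real (card ?B) \<le> \<beta> * (r\<^sup>2 / (log_star r)\<^sup>2)"
    using sep Tr by (simp add: separation_condition_def)
  ultimately show ?thesis by linarith
qed

lemma has_integral_inverse_above:
  assumes "0 < r0" "r0 \<le> R" "a < R"
  shows "((\<lambda>r. if a < r then 1 / r else 0) has_integral (ln R - ln (max r0 a))) {r0..R::real}"
proof -
  define m where "m = max r0 a"
  have m: "0 < m" "m \<le> R" "r0 \<le> m" using assms by (auto simp: m_def)
  have "((\<lambda>r. 1 / r) has_integral (ln R - ln m)) {m..R}"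
    by (rule fundamental_theorem_of_calculus[OF m(2)])
      (use m in \<open>auto intro!: derivative_eq_intros simp: has_real_derivative_iff_has_vector_derivative[symmetric]\<close>)
  then have "((\<lambda>r. if r \<in> {m..R} then 1 / r else 0) has_integral (ln R - ln m)) {r0..R}"
    by (subst has_integral_restrict) (use m in auto)
  then show ?thesis unfolding m_def[symmetric]
    by (rule has_integral_spike_finite[of "{m}", rotated 2]) (auto simp: m_def)
qed

text \<open>
The logarithm of \<open>R / max r0 (a j)\<close> is the integral of \<open>1/r\<close> over those \<open>r\<close> in \<open>[r0, R]\<close> that
exceed \<open>a j\<close>; summed over \<open>j\<close> this turns the product into the integral of the counting function
divided by \<open>r\<close>, as in Jensen's formula.  Cutting off at \<open>r0\<close> only enlarges the product, and admits
points at the centre.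
\<close>
lemma prod_le_exp_of_count:
  fixes a :: "'a \<Rightarrow> real"
  assumes J: "finite J" "\<And>j. j \<in> J \<Longrightarrow> 0 \<le> a j \<and> a j < R" and r0: "0 < r0" "r0 \<le> R"
    and cnt: "\<And>r. r0 \<le> r \<Longrightarrow> r \<le> R \<Longrightarrow> c * r\<^sup>2 - d * r \<le> real (card {j\<in>J. a j < r})"
  shows "(\<Prod>j\<in>J. a j / R) \<le> exp (- (c * (R\<^sup>2 - r0\<^sup>2) / 2 - d * (R - r0)))"
proof -
  have 1: "((\<lambda>r. \<Sum>j\<in>J. if a j < r then 1 / r else 0) has_integral (\<Sum>j\<in>J. ln R - ln (max r0 (a j)))) {r0..R}"
    by (rule has_integral_sum[OF J(1) has_integral_inverse_above]) (use J r0 in auto)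
  have 2: "((\<lambda>r. c * r - d) has_integral ((c * R\<^sup>2 / 2 - d * R) - (c * r0\<^sup>2 / 2 - d * r0))) {r0..R}"
    by (rule fundamental_theorem_of_calculus[OF r0(2)])
      (auto intro!: derivative_eq_intros simp: has_real_derivative_iff_has_vector_derivative[symmetric])
  have "(c * R\<^sup>2 / 2 - d * R) - (c * r0\<^sup>2 / 2 - d * r0) \<le> (\<Sum>j\<in>J. ln R - ln (max r0 (a j)))"
  proof (rule has_integral_le[OF 2 1])
    fix r assume r: "r \<in> {r0..R}"
    have "(\<Sum>j\<in>J. if a j < r then 1 / r else 0) = real (card {j\<in>J. a j < r}) / r"
      using J(1) by (simp add: sum.If_cases Int_def conj_commute)
    moreover have "(c * r\<^sup>2 - d * r) / r \<le> real (card {j\<in>J. a j < r}) / r"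
      by (rule divide_right_mono[OF cnt]) (use r r0 in auto)
    moreover have "(c * r\<^sup>2 - d * r) / r = c * r - d"
      using r r0 by (simp add: diff_divide_distrib power2_eq_square)
    ultimately show "c * r - d \<le> (\<Sum>j\<in>J. if a j < r then 1 / r else 0)" by simp
  qed
  then have le: "c * (R\<^sup>2 - r0\<^sup>2) / 2 - d * (R - r0) \<le> (\<Sum>j\<in>J. ln R - ln (max r0 (a j)))"
    by (simp add: algebra_simps diff_divide_distrib)
  have "(\<Prod>j\<in>J. a j / R) \<le> (\<Prod>j\<in>J. max r0 (a j) / R)"
    by (rule prod_mono) (use J r0 in \<open>auto intro!: divide_right_mono\<close>)
  also have "\<dots> = (\<Prod>j\<in>J. exp (- (ln R - ln (max r0 (a j)))))"
    by (rule prod.cong) (use r0 in \<open>auto simp: exp_diff less_max_iff_disj\<close>)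
  also have "\<dots> = exp (- (\<Sum>j\<in>J. ln R - ln (max r0 (a j))))"
    using J(1) by (simp add: exp_sum sum_negf[symmetric] del: minus_diff_eq)
  also have "\<dots> \<le> exp (- (c * (R\<^sup>2 - r0\<^sup>2) / 2 - d * (R - r0)))" using le by simp
  finally show ?thesis .
qed

section \<open>Decay of the Blaschke product at the centre\<close>

text \<open>
The counting function of the well separated points is at least \<open>L (r - s)\<^sup>2 - l r\<^sup>2 / 8\<close> for
\<open>r \<ge> r0 = l R / 8\<close>: the second hypothesis on \<open>ln (l R / 8)\<close> makes the discarded points a fraction
\<open>l / 8\<close> of \<open>r\<^sup>2\<close>.  The part of the disc inside \<open>r0\<close> and the displacement \<open>s\<close> each cost a further small
fraction of \<open>L l R\<^sup>2\<close>, so at least half of the surplus \<open>l\<close> of \<open>L\<close> over \<open>1\<close> survives.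
\<close>
lemma blaschke_product_decay:
  assumes P: "perturbed_lattice L T z" and sep: "separation_condition \<beta> T S z"
    and l: "0 < l" "l \<le> 1" "1 + l \<le> L" and R: "R > 0" and \<beta>: "\<beta> \<ge> 0"
    and s: "T (1 + cmod w) + ln (1 + R) + 2 \<le> l * R / 64"
    and r0: "ln (l * R / 8) \<ge> 1" "8 * \<beta> \<le> l * (ln (l * R / 8))\<^sup>2"
  shows "(\<Prod>i | z i \<in> ball w R \<and> well_separated S z i. cmod (z i - w) / R) \<le> exp (- ((1 + l / 2) * R\<^sup>2 / 2))"
proof -
  let ?J = "{i. z i \<in> ball w R \<and> well_separated S z i}"
  define q where "q = l * R / 8"
  define s' where "s' = T (1 + cmod w) + ln (1 + R) + 2"
  have L: "L \<ge> 1" using l by simp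
  have fin: "finite ?J"
    by (rule finite_subset[OF _ finite_perturbed_ball[OF P L, of w R]]) auto
  have q: "0 < q" "q \<le> R" using l R by (auto simp: q_def mult_le_one)
  have "l * R \<ge> 0" using l R by simp
  then have s'q: "s' \<le> q" using s unfolding s'_def q_def by linarith
  have cnt: "(L - l / 8) * r\<^sup>2 - (2 * L * s') * r \<le> real (card {i \<in> ?J. cmod (z i - w) < r})"
    if r: "q \<le> r" "r \<le> R" for r
  proof -
    have lr: "ln q \<le> log_star r" unfolding log_star_def using r q by (simp add: le_max_iff_disj)
    have "(ln q)\<^sup>2 \<le> (log_star r)\<^sup>2" using lr r0(1) unfolding q_def by (intro power_mono) auto
    then have "8 * \<beta> \<le> l * (log_star r)\<^sup>2"
      using r0(2) l unfolding q_def[symmetric] by (meson mult_left_mono order_trans less_imp_le)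
    moreover have "(log_star r)\<^sup>2 > 0" by (simp add: log_star_def)
    ultimately have "\<beta> / (log_star r)\<^sup>2 \<le> l / 8" by (simp add: pos_divide_le_eq)
    then have "\<beta> / (log_star r)\<^sup>2 * r\<^sup>2 \<le> l / 8 * r\<^sup>2" by (rule mult_right_mono) simp
    then have b: "\<beta> * (r\<^sup>2 / (log_star r)\<^sup>2) \<le> l / 8 * r\<^sup>2" by simp
    have "L * (r - s')\<^sup>2 - \<beta> * (r\<^sup>2 / (log_star r)\<^sup>2) \<le> real (card {i. z i \<in> ball w r \<and> well_separated S z i})"
      by (rule card_well_separated_ge[OF P sep L _ s'_def]) (use r s'q R in auto)
    also have "{i. z i \<in> ball w r \<and> well_separated S z i} = {i \<in> ?J. cmod (z i - w) < r}"
      using r by (auto simp: dist_norm norm_minus_commute)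
    finally have "L * (r - s')\<^sup>2 - \<beta> * (r\<^sup>2 / (log_star r)\<^sup>2) \<le> real (card {i \<in> ?J. cmod (z i - w) < r})" .
    moreover have "L * (r - s')\<^sup>2 = L * r\<^sup>2 - 2 * L * s' * r + L * s'\<^sup>2"
      by (simp add: power2_eq_square algebra_simps)
    moreover have "L * s'\<^sup>2 \<ge> 0" using L by simp
    moreover have "(L - l / 8) * r\<^sup>2 = L * r\<^sup>2 - l / 8 * r\<^sup>2" by (simp add: algebra_simps)
    ultimately show ?thesis using b by linarith
  qed
  have "(\<Prod>i\<in>?J. cmod (z i - w) / R) \<le> exp (- ((L - l / 8) * (R\<^sup>2 - q\<^sup>2) / 2 - (2 * L * s') * (R - q)))"
    by (rule prod_le_exp_of_count[OF fin _ q cnt]) (auto simp: dist_norm norm_minus_commute)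
  also have "\<dots> \<le> exp (- ((1 + l / 2) * R\<^sup>2 / 2))"
  proof -
    have 1: "2 * L * s' * (R - q) \<le> L * l / 32 * R\<^sup>2"
    proof -
      have "s' * (R - q) \<le> (l * R / 64) * R"
      proof (rule mult_mono)
        show "s' \<le> l * R / 64" using s by (simp add: s'_def)
      qed (use q l R in auto)
      then have "2 * L * (s' * (R - q)) \<le> 2 * L * ((l * R / 64) * R)"
        using L by (intro mult_left_mono) auto
      then show ?thesis by (simp add: power2_eq_square mult_ac)
    qed
    have 2: "(L - l / 8) * (R\<^sup>2 - q\<^sup>2) \<ge> (L - l / 8 - L * l / 64) * R\<^sup>2"
    proof -
      have "q\<^sup>2 = l\<^sup>2 / 64 * R\<^sup>2" by (simp add: q_def power_mult_distrib power_divide)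
      moreover have "l\<^sup>2 \<le> l" using l by (simp add: power2_eq_square mult_left_le_one_le)
      ultimately have "q\<^sup>2 \<le> l / 64 * R\<^sup>2" by (simp add: mult_right_mono)
      then have "(L - l / 8) * q\<^sup>2 \<le> L * (l / 64 * R\<^sup>2)"
        using l L by (intro mult_mono) auto
      then show ?thesis by (simp add: algebra_simps)
    qed
    \<comment> \<open>This is increasing in \<open>L\<close>, so \<open>L = 1 + l\<close> is the critical case.\<close>
    have 3: "1 + l / 2 \<le> L - l / 8 - L * l / 64 - L * l / 16"
    proof -
      have "(1 + l) * (1 - 5 * l / 64) \<le> L * (1 - 5 * l / 64)"
        using l by (intro mult_right_mono) auto
      moreover have "l * l \<le> l" using l by (simp add: mult_left_le_one_le)
      moreover have "(1 + l) * (1 - 5 * l / 64) = 1 + l - 5 * l / 64 - 5 * (l * l) / 64"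
        "L * (1 - 5 * l / 64) = L - 5 * (L * l) / 64" by (simp_all add: field_simps)
      ultimately show ?thesis using l by linarith
    qed
    have "(1 + l / 2) * R\<^sup>2 \<le> (L - l / 8 - L * l / 64 - L * l / 16) * R\<^sup>2"
      using 3 by (rule mult_right_mono) simp
    then have "(1 + l / 2) * R\<^sup>2 / 2 \<le> (L - l / 8) * (R\<^sup>2 - q\<^sup>2) / 2 - (2 * L * s') * (R - q)"
    proof -
      have "(L - l / 8 - L * l / 64 - L * l / 16) * R\<^sup>2 = (L - l / 8 - L * l / 64) * R\<^sup>2 - 2 * (L * l / 32 * R\<^sup>2)"
        by (simp add: algebra_simps)
      then show ?thesis using 1 2 \<open>(1 + l / 2) * R\<^sup>2 \<le> _\<close> by linarith
    qed
    then show ?thesis unfolding exp_le_cancel_iff by linarith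
  qed
  finally show ?thesis .
qed

section \<open>The local estimate\<close>

lemma log_star_mono: "0 < x \<Longrightarrow> x \<le> y \<Longrightarrow> log_star x \<le> log_star y"
  unfolding log_star_def by (intro max.mono) simp_all

text \<open>
The modulus of \<open>f\<close> in the metric for which the Fock space norm is an unweighted \<open>L\<^sup>p\<close> norm.
\<close>
definition fock_modulus :: "(complex \<Rightarrow> complex) \<Rightarrow> complex \<Rightarrow> real"
  where "fock_modulus f u = cmod (f u) * exp (- ((cmod u)\<^sup>2 / 2))"

lemma fock_modulus_nonneg [simp]: "0 \<le> fock_modulus f u"
  by (simp add: fock_modulus_def)

lemma holomorphic_fock_modulus_continuous:
  "f holomorphic_on UNIV \<Longrightarrow> continuous_on UNIV (fock_modulus f)"
  unfolding fock_modulus_def using holomorphic_on_imp_continuous_on by (intro continuous_intros) auto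

lemma fock_modulus_powr:
  "fock_modulus f u powr p = cmod (f u) powr p * exp (- (p / 2 * (cmod u)\<^sup>2))"
  by (simp add: fock_modulus_def powr_mult exp_powr_real mult_ac)

text \<open>
The Weyl translate of \<open>f\<close> has the same weighted modulus as \<open>f\<close>, shifted by \<open>w\<close>.
\<close>
lemma fock_translate:
  "cmod (f (w + \<zeta>) * exp (- cnj w * \<zeta> - of_real ((cmod w)\<^sup>2 / 2))) = fock_modulus f (w + \<zeta>) * exp ((cmod \<zeta>)\<^sup>2 / 2)"
proof -
  have "(cmod (w + \<zeta>))\<^sup>2 = (cmod w)\<^sup>2 + 2 * Re (cnj w * \<zeta>) + (cmod \<zeta>)\<^sup>2"
    unfolding cmod_power2 by (simp add: power2_eq_square algebra_simps)
  then have "Re (- cnj w * \<zeta> - of_real ((cmod w)\<^sup>2 / 2)) = - ((cmod (w + \<zeta>))\<^sup>2 / 2) + (cmod \<zeta>)\<^sup>2 / 2"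
    by (simp add: field_simps)
  then have "exp (Re (- cnj w * \<zeta> - of_real ((cmod w)\<^sup>2 / 2))) = exp (- ((cmod (w + \<zeta>))\<^sup>2 / 2)) * exp ((cmod \<zeta>)\<^sup>2 / 2)"
    by (simp only: exp_add)
  then show ?thesis by (simp add: norm_mult norm_exp_eq_Re fock_modulus_def del: Re_divide_of_nat)
qed

text \<open>
A repeated entry makes the product separation zero, whereas \<open>S\<close> is positive.
\<close>
lemma well_separated_distinct:
  assumes P: "perturbed_lattice L T z" and L: "L \<ge> 1" and S: "\<And>r. r \<ge> 0 \<Longrightarrow> S r > 0"
    and g: "well_separated S z i" and ne: "j \<noteq> i"
  shows "z j \<noteq> z i"
proof
  assume eq: "z j = z i"
  have "finite {j. j \<noteq> i \<and> z j \<in> ball (z i) 1}"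
    by (rule finite_subset[OF _ finite_perturbed_ball[OF P L, of "z i" 1]]) auto
  then have "product_separation z i = 0"
    unfolding product_separation_def 
  proof (rule prod_zero)
    show "\<exists>j\<in>{j. j \<noteq> i \<and> z j \<in> ball (z i) 1}. cmod (z i - z j) = 0"
      by (rule bexI[of _ j]) (use eq ne in simp_all)
  qed
  then show False using g S[of "cmod (z i)"] by (simp add: well_separated_def)
qed

text \<open>
Only the points within distance \<open>1\<close> of \<open>z i\<close> can make the left side exceed \<open>(2R)\<close> to the number
of points, and their distances are factors of the product separation; the other factors of the product separation are
less than \<open>1\<close>.
\<close>
lemma prod_inverse_dist_le:
  assumes P: "perturbed_lattice L T z" and L: "L \<ge> 1" and S: "\<And>r. r \<ge> 0 \<Longrightarrow> S r > 0"
    and g: "well_separated S z i" and J: "finite J" "i \<in> J" and R: "2 * R \<ge> 1"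
  shows "(\<Prod>j\<in>J-{i}. 2 * R / cmod (z i - z j)) \<le> (2 * R) ^ card J / S (cmod (z i))"
proof -
  let ?N = "{j. j \<noteq> i \<and> z j \<in> ball (z i) 1}"
  define N where "N = (J - {i}) \<inter> ?N"
  have finN: "finite ?N"
    by (rule finite_subset[OF _ finite_perturbed_ball[OF P L, of "z i" 1]]) auto
  have ne: "z j \<noteq> z i" if "j \<noteq> i" for j by (rule well_separated_distinct[OF P L S g that])
  have near: "product_separation z i \<le> (\<Prod>j\<in>N. cmod (z i - z j))"
  proof -
    have "product_separation z i = (\<Prod>j\<in>?N - N. cmod (z i - z j)) * (\<Prod>j\<in>N. cmod (z i - z j))"
      unfolding product_separation_def by (rule prod.subset_diff[OF _ finN]) (simp add: N_def)
    also have "\<dots> \<le> 1 * (\<Prod>j\<in>N. cmod (z i - z j))"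
      by (intro mult_right_mono prod_le_1 prod_nonneg) (auto simp: dist_norm)
    finally show ?thesis by simp
  qed
  have Sp: "0 < S (cmod (z i))" by (rule S) simp
  have pos: "0 < (\<Prod>j\<in>N. cmod (z i - z j))"
    by (rule prod_pos) (use ne in \<open>force simp: N_def\<close>)
  have "(\<Prod>j\<in>J-{i}. 2 * R / cmod (z i - z j)) \<le> (\<Prod>j\<in>J-{i}. 2 * R * (if j \<in> N then 1 / cmod (z i - z j) else 1))"
  proof (rule prod_mono)
    fix j assume j: "j \<in> J - {i}"
    have "2 * R / cmod (z i - z j) \<le> 2 * R" if "j \<notin> N"
    proof -
      have "1 \<le> cmod (z i - z j)" using that j by (simp add: N_def dist_norm)
      then show ?thesis using R frac_le[of "2*R" "2*R" 1 "cmod (z i - z j)"] by simp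
    qed
    then show "0 \<le> 2 * R / cmod (z i - z j) \<and> 2 * R / cmod (z i - z j) \<le> 2 * R * (if j \<in> N then 1 / cmod (z i - z j) else 1)"
      using R by auto
  qed
  also have "\<dots> = (2 * R) ^ card (J - {i}) * (\<Prod>j\<in>J-{i}. if j \<in> N then 1 / cmod (z i - z j) else 1)"
    by (simp add: prod.distrib)
  also have "(\<Prod>j\<in>J-{i}. if j \<in> N then 1 / cmod (z i - z j) else 1) = (\<Prod>j\<in>N. 1 / cmod (z i - z j))"
    by (rule prod.mono_neutral_cong_right) (use J in \<open>auto simp: N_def\<close>)
  also have "\<dots> = 1 / (\<Prod>j\<in>N. cmod (z i - z j))" by (simp add: prod_dividef)
  also have "(2 * R) ^ card (J - {i}) * (1 / (\<Prod>j\<in>N. cmod (z i - z j))) \<le> (2 * R) ^ card J * (1 / S (cmod (z i)))"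
  proof (rule mult_mono)
    show "(2 * R) ^ card (J - {i}) \<le> (2 * R) ^ card J"
      by (rule power_increasing[OF _ R]) (use J in \<open>auto intro: card_mono\<close>)
    have "S (cmod (z i)) \<le> (\<Prod>j\<in>N. cmod (z i - z j))" using near g by (simp add: well_separated_def)
    then show "1 / (\<Prod>j\<in>N. cmod (z i - z j)) \<le> 1 / S (cmod (z i))" using Sp by (simp add: frac_le)
  qed (use R pos in auto)
  finally show ?thesis by simp
qed

lemma powr_ge_tangent:
  fixes x m p :: real
  assumes "p \<ge> 1" "m > 0" "x \<ge> 0"
  shows "x powr p \<ge> m powr p + p * m powr (p - 1) * (x - m)"
proof (cases "x = 0")
  case True
  have e: "m powr (p - 1) * m = m powr p" using assms powr_add[of m "p - 1" 1] by simp
  have "p * m powr (p - 1) * (x - m) = - (p * (m powr (p - 1) * m))" using True by simp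
  also have "\<dots> = - (p * m powr p)" by (simp only: e)
  finally have "p * m powr (p - 1) * (x - m) = - (p * m powr p)" .
  moreover have "m powr p \<le> p * m powr p" using assms mult_right_mono[of 1 p "m powr p"] by simp
  moreover have "x powr p = 0" using True by simp
  ultimately show ?thesis by linarith
next
  case False
  have "x powr p - m powr p \<ge> (p * m powr (p - 1)) * (x - m)"
  proof (rule convex_on_imp_above_tangent[of "{0<..}" "\<lambda>x. x powr p"])
    show "convex_on {0<..} (\<lambda>x. x powr p)" using powr_convex assms by auto
    show "((\<lambda>x. x powr p) has_real_derivative p * m powr (p - 1)) (at m within {0<..})"
      using assms by (auto intro!: derivative_eq_intros)
  qed (use assms False in \<open>auto simp: interior_open\<close>)
  then show ?thesis by simp
qed

text \<open>
Jensen's inequality on the unit interval, by integrating the tangent inequality at the mean.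
\<close>
lemma integral_powr_le:
  fixes g :: "real \<Rightarrow> real"
  assumes p: "p \<ge> 1" and g: "continuous_on {0..1} g" "\<And>t. t \<in> {0..1} \<Longrightarrow> 0 \<le> g t"
  shows "(integral {0..1} g) powr p \<le> integral {0..1} (\<lambda>t. g t powr p)"
proof -
  define m where "m = integral {0..1} g"
  have gi: "g integrable_on {0..1}" by (rule integrable_continuous_real[OF g(1)])
  have cp: "continuous_on {0..1} (\<lambda>t. g t powr p)"
    by (rule continuous_on_powr') (use g p in \<open>auto intro!: continuous_intros\<close>)
  then have gpi: "(\<lambda>t. g t powr p) integrable_on {0..1}" by (rule integrable_continuous_real)
  have m0: "m \<ge> 0" unfolding m_def by (rule integral_nonneg[OF gi g(2)])
  show ?thesis
  proof (cases "m = 0")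
    case True
    then show ?thesis using integral_nonneg[OF gpi] by (simp add: m_def[symmetric])
  next
    case False
    then have m: "m > 0" using m0 by simp
    have i: "((\<lambda>t. m powr p + p * m powr (p - 1) * (g t - m)) has_integral
        m powr p + p * m powr (p - 1) * (m - m)) {0..1}"
    proof -
      have c: "((\<lambda>t. c) has_integral c) {0..1::real}" for c :: real
        using has_integral_const_real[of c 0 1] by simp
      have "(g has_integral m) {0..1}" unfolding m_def by (rule integrable_integral[OF gi])
      from has_integral_add[OF c has_integral_mult_right[OF has_integral_diff[OF this c]]]
      show ?thesis .
    qed
    have "m powr p + p * m powr (p - 1) * (m - m) \<le> integral {0..1} (\<lambda>t. g t powr p)"
      by (rule has_integral_le[OF i integrable_integral[OF gpi]])
        (use powr_ge_tangent[OF p m] g in auto)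
    then show ?thesis by (simp add: m_def)
  qed
qed

text \<open>
All summands are bounded by the largest one.  The crude factor is harmless because the number of
points is polynomial in \<open>R\<close>.
\<close>
lemma powr_add_sum_le:
  fixes p x :: real
  assumes "finite J" "p \<ge> 0" "x \<ge> 0" "\<And>j. j \<in> J \<Longrightarrow> y j \<ge> 0"
  shows "(x + (\<Sum>j\<in>J. y j)) powr p \<le> (real (card J) + 1) powr p * (x powr p + (\<Sum>j\<in>J. y j powr p))"
proof -
  define M where "M = Max (insert x (y ` J))"
  have fin: "finite (insert x (y ` J))" using assms(1) by auto
  have le: "x \<le> M" "\<And>j. j \<in> J \<Longrightarrow> y j \<le> M" unfolding M_def using fin by auto
  have "M \<in> insert x (y ` J)" unfolding M_def using fin by (intro Max_in) auto
  then have "M powr p \<le> x powr p + (\<Sum>j\<in>J. y j powr p)"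
  proof
    assume "M = x" then show ?thesis by (simp add: sum_nonneg)
  next
    assume "M \<in> y ` J"
    then obtain j where j: "j \<in> J" "M = y j" by auto
    then have "M powr p \<le> (\<Sum>j\<in>J. y j powr p)"
      using member_le_sum[of j J "\<lambda>j. y j powr p"] assms(1) by auto
    then show ?thesis by (simp add: add_increasing)
  qed
  moreover have "x + (\<Sum>j\<in>J. y j) \<le> (real (card J) + 1) * M"
    using le(1) sum_bounded_above[of J y M] le(2) by (simp add: algebra_simps)
  then have "(x + (\<Sum>j\<in>J. y j)) powr p \<le> ((real (card J) + 1) * M) powr p"
    using assms by (intro powr_mono2) (auto intro!: add_nonneg_nonneg sum_nonneg)
  moreover have "\<dots> = (real (card J) + 1) powr p * M powr p"
    using assms(3) le(1) by (simp add: powr_mult)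
  moreover have "(real (card J) + 1) powr p * M powr p \<le> (real (card J) + 1) powr p * (x powr p + (\<Sum>j\<in>J. y j powr p))"
    by (rule mult_left_mono) (use calculation(1) in auto)
  ultimately show ?thesis by linarith
qed

text \<open>
The translated function is interpolated at the points \<open>z i - w\<close>.  Its mean over the circle carries
the factor \<open>exp (R\<^sup>2 / 2)\<close>, and the Blaschke product beats it by \<open>exp (- l R\<^sup>2 / 4)\<close>.
\<close>
lemma local_interpolation:
  assumes P: "perturbed_lattice L T z" and sep: "separation_condition \<beta> T S z"
    and l: "0 < l" "l \<le> 1" "1 + l \<le> L" and R: "2 * R \<ge> 1" and \<beta>: "\<beta> \<ge> 0"
    and s: "T (1 + cmod w) + ln (1 + R) + 2 \<le> l * R / 64"
    and r0: "ln (l * R / 8) \<ge> 1" "8 * \<beta> \<le> l * (ln (l * R / 8))\<^sup>2"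
    and f: "f holomorphic_on UNIV"
    and J_def: "J = {i. z i \<in> ball w R \<and> well_separated S z i}"
  shows "fock_modulus f w \<le> exp (- (l * R\<^sup>2 / 4)) * integral {0..1} (\<lambda>t. fock_modulus f (w + circlepath 0 R t))
    + (\<Sum>i\<in>J. 2 * (2 * R) ^ card J * exp (R\<^sup>2 / 2) * (fock_modulus f (z i) / S (cmod (z i))))"
proof -
  define F where "F = (\<lambda>\<zeta>. f (w + \<zeta>) * exp (- cnj w * \<zeta> - of_real ((cmod w)\<^sup>2 / 2)))"
  define A where "A = (\<lambda>i. z i - w) ` J"
  have L: "L \<ge> 1" using l by simp
  have R0: "R > 0" using R by simp
  have Spos: "S r > 0" if "r \<ge> 0" for r using sep that by (simp add: separation_condition_def)
  have fin: "finite J" unfolding J_def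
    by (rule finite_subset[OF _ finite_perturbed_ball[OF P L, of w R]]) auto
  have inj: "inj_on (\<lambda>i. z i - w) J"
  proof (rule inj_onI, rule ccontr)
    fix i j assume ij: "i \<in> J" "j \<in> J" "z i - w = z j - w" "i \<noteq> j"
    have "z j \<noteq> z i" by (rule well_separated_distinct[OF P L Spos]) (use ij in \<open>auto simp: J_def\<close>)
    then show False using ij by simp
  qed
  have AR: "A \<subseteq> ball 0 R" by (auto simp: A_def J_def dist_norm norm_minus_commute)
  have F: "F holomorphic_on UNIV"
  proof -
    have "(\<lambda>\<zeta>. w + \<zeta>) holomorphic_on UNIV" by (rule holomorphic_on_add) auto
    from holomorphic_on_compose_gen[OF this f] have "(\<lambda>\<zeta>. f (w + \<zeta>)) holomorphic_on UNIV"
      by (simp add: o_def)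
    then show ?thesis unfolding F_def by (intro holomorphic_intros)
  qed
  have cF: "cmod (F \<zeta>) = fock_modulus f (w + \<zeta>) * exp ((cmod \<zeta>)\<^sup>2 / 2)" for \<zeta>
    unfolding F_def by (rule fock_translate)
  let ?I = "integral {0..1} (\<lambda>t. fock_modulus f (w + circlepath 0 R t))"
  have "integral {0..1} (\<lambda>t. cmod (F (circlepath 0 R t))) = integral {0..1} (\<lambda>t. fock_modulus f (w + circlepath 0 R t) * exp (R\<^sup>2 / 2))"
    unfolding cF by (simp add: circlepath norm_mult)
  then have I: "integral {0..1} (\<lambda>t. cmod (F (circlepath 0 R t))) = ?I * exp (R\<^sup>2 / 2)" by simp
  have fmc: "continuous_on UNIV (fock_modulus f)"
    by (rule holomorphic_fock_modulus_continuous[OF f])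
  have "continuous_on {0..1} (\<lambda>t. fock_modulus f (w + circlepath 0 R t))"
    by (rule continuous_on_compose2[OF fmc]) (auto simp: circlepath_def part_circlepath_def intro!: continuous_intros)
  then have I0: "?I \<ge> 0" by (intro integral_nonneg integrable_continuous_real) auto
  have Pr: "(\<Prod>a\<in>A. cmod a / R) \<le> exp (- ((1 + l / 2) * R\<^sup>2 / 2))"
  proof -
    have "(\<Prod>a\<in>A. cmod a / R) = (\<Prod>i\<in>J. cmod (z i - w) / R)"
      unfolding A_def by (simp add: prod.reindex[OF inj])
    also have "\<dots> \<le> exp (- ((1 + l / 2) * R\<^sup>2 / 2))"
      unfolding J_def by (rule blaschke_product_decay[OF P sep l R0 \<beta> s r0])
    finally show ?thesis .
  qed
  have summand: "cmod (F (z i - w)) * (\<Prod>c\<in>A-{z i - w}. 2 * R / cmod (z i - w - c))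
      \<le> (2 * R) ^ card J * exp (R\<^sup>2 / 2) * (fock_modulus f (z i) / S (cmod (z i)))" if i: "i \<in> J" for i
  proof -
    have "A - {z i - w} = (\<lambda>j. z j - w) ` (J - {i})"
      unfolding A_def using inj i by (auto dest: inj_onD)
    moreover have "inj_on (\<lambda>i. z i - w) (J - {i})" using inj by (rule inj_on_subset) auto
    ultimately have "(\<Prod>c\<in>A-{z i - w}. 2 * R / cmod (z i - w - c)) = (\<Prod>j\<in>J-{i}. 2 * R / cmod (z i - z j))"
      by (simp add: prod.reindex o_def)
    also have "\<dots> \<le> (2 * R) ^ card J / S (cmod (z i))"
      by (rule prod_inverse_dist_le[OF P L Spos _ fin i R]) (use i in \<open>auto simp: J_def\<close>)
    finally have 1: "(\<Prod>c\<in>A-{z i - w}. 2 * R / cmod (z i - w - c)) \<le> (2 * R) ^ card J / S (cmod (z i))" .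
    have "cmod (z i - w) \<le> R" using i by (simp add: J_def dist_norm norm_minus_commute)
    then have "(cmod (z i - w))\<^sup>2 \<le> R\<^sup>2" by (intro power_mono) auto
    then have 2: "cmod (F (z i - w)) \<le> fock_modulus f (z i) * exp (R\<^sup>2 / 2)"
      unfolding cF by (intro mult_mono) auto
    have "cmod (F (z i - w)) * (\<Prod>c\<in>A-{z i - w}. 2 * R / cmod (z i - w - c))
      \<le> (fock_modulus f (z i) * exp (R\<^sup>2 / 2)) * ((2 * R) ^ card J / S (cmod (z i)))"
      by (rule mult_mono[OF 2 1]) (use R in \<open>auto intro!: prod_nonneg\<close>)
    then show ?thesis by (simp add: mult_ac)
  qed
  have "fock_modulus f w = cmod (F 0)" using cF[of 0] by simp
  also have "\<dots> \<le> (\<Prod>a\<in>A. cmod a / R) * integral {0..1} (\<lambda>t. cmod (F (circlepath 0 R t)))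
           + 2 * (\<Sum>a\<in>A. cmod (F a) * (\<Prod>c\<in>A-{a}. 2 * R / cmod (a - c)))"
    by (rule interpolation_bound[OF _ AR R0 F]) (simp add: A_def fin)
  also have "\<dots> \<le> exp (- ((1 + l / 2) * R\<^sup>2 / 2)) * (?I * exp (R\<^sup>2 / 2)) +
      2 * (\<Sum>i\<in>J. (2 * R) ^ card J * exp (R\<^sup>2 / 2) * (fock_modulus f (z i) / S (cmod (z i))))"
  proof (rule add_mono)
    show "(\<Prod>a\<in>A. cmod a / R) * integral {0..1} (\<lambda>t. cmod (F (circlepath 0 R t))) \<le> exp (- ((1 + l / 2) * R\<^sup>2 / 2)) * (?I * exp (R\<^sup>2 / 2))"
      unfolding I by (rule mult_right_mono[OF Pr]) (use I0 in simp)
    have "(\<Sum>a\<in>A. cmod (F a) * (\<Prod>c\<in>A-{a}. 2 * R / cmod (a - c))) =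
        (\<Sum>i\<in>J. cmod (F (z i - w)) * (\<Prod>c\<in>A-{z i - w}. 2 * R / cmod (z i - w - c)))"
      by (subst (1) A_def) (simp add: sum.reindex[OF inj] o_def)
    also have "\<dots> \<le> (\<Sum>i\<in>J. (2 * R) ^ card J * exp (R\<^sup>2 / 2) * (fock_modulus f (z i) / S (cmod (z i))))"
      by (rule sum_mono[OF summand])
    finally show "2 * (\<Sum>a\<in>A. cmod (F a) * (\<Prod>c\<in>A-{a}. 2 * R / cmod (a - c))) \<le>
       2 * (\<Sum>i\<in>J. (2 * R) ^ card J * exp (R\<^sup>2 / 2) * (fock_modulus f (z i) / S (cmod (z i))))" by simp
  qed
  also have "exp (- ((1 + l / 2) * R\<^sup>2 / 2)) * (?I * exp (R\<^sup>2 / 2)) = exp (- (l * R\<^sup>2 / 4)) * ?I"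
  proof -
    have "- ((1 + l / 2) * R\<^sup>2 / 2) + R\<^sup>2 / 2 = - (l * R\<^sup>2 / 4)" by (simp add: algebra_simps)
    then have e: "exp (- ((1 + l / 2) * R\<^sup>2 / 2)) * exp (R\<^sup>2 / 2) = exp (- (l * R\<^sup>2 / 4))"
      by (simp only: exp_add[symmetric])
    have "a * (b * c) = (a * c) * b" for a b c :: real by simp
    then show ?thesis unfolding e[symmetric] .
  qed
  finally show ?thesis by (simp only: sum_distrib_left mult.assoc)
qed

lemma separation_weight_le:
  assumes P: "perturbed_lattice L T z" and sep: "separation_condition \<beta> T S z"
  shows "1 / S (cmod u) \<le> exp ((T (1 + cmod u))\<^sup>2 * (log_star (T (1 + cmod u))) ^ 4)"
proof -
  have Sp: "S (cmod u) > 0" and le: "- ln (S (cmod u)) \<le> (T (cmod u))\<^sup>2 * (log_star (T (cmod u))) ^ 4"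
    using sep by (simp_all add: separation_condition_def)
  have T1: "1 \<le> T (cmod u)" using P by (simp add: perturbed_lattice_def)
  have TT: "T (cmod u) \<le> T (1 + cmod u)" by (rule perturbed_lattice_mono[OF P]) auto
  have "log_star (T (cmod u)) \<le> log_star (T (1 + cmod u))"
    by (rule log_star_mono) (use T1 TT in auto)
  moreover have "1 \<le> log_star (T (cmod u))" by (simp add: log_star_def)
  ultimately have "(T (cmod u))\<^sup>2 * (log_star (T (cmod u))) ^ 4 \<le> (T (1 + cmod u))\<^sup>2 * (log_star (T (1 + cmod u))) ^ 4"
    using T1 TT by (intro mult_mono power_mono) auto
  then have "exp (- ln (S (cmod u))) \<le> exp ((T (1 + cmod u))\<^sup>2 * (log_star (T (1 + cmod u))) ^ 4)"
    using le by simp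
  then show ?thesis using Sp by (simp add: exp_minus inverse_eq_divide)
qed

text \<open>
The number \<open>N\<close> bounds how many points are used; it is kept as a parameter so that the constants
depend on \<open>L\<close> only through an upper bound.  The sum is extended from the well separated points to
all points of the disc, after which no trace of \<open>S\<close> is left on the right.
\<close>
lemma local_estimate:
  assumes P: "perturbed_lattice L T z" and sep: "separation_condition \<beta> T S z"
    and l: "0 < l" "l \<le> 1" "1 + l \<le> L" and R: "R \<ge> 1" and \<beta>: "\<beta> \<ge> 0"
    and s: "T (1 + cmod w) + ln (1 + R) + 2 \<le> l * R / 64"
    and r0: "ln (l * R / 8) \<ge> 1" "8 * \<beta> \<le> l * (ln (l * R / 8))\<^sup>2"
    and f: "f holomorphic_on UNIV" and p: "p \<ge> 1" and LN: "225 * L * R\<^sup>2 \<le> N"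
  shows "fock_modulus f w powr p \<le>
      (N + 1) powr p * exp (- (p * l * R\<^sup>2 / 4)) * integral {0..1} (\<lambda>t. fock_modulus f (w + circlepath 0 R t) powr p)
    + (\<Sum>i | z i \<in> ball w R.
        (N + 1) powr p * (2 * (2 * R) powr N * exp (R\<^sup>2 / 2)) powr p
          * exp (p * (T (1 + cmod (z i)))\<^sup>2 * (log_star (T (1 + cmod (z i)))) ^ 4) * fock_modulus f (z i) powr p)"
proof -
  define J where "J = {i. z i \<in> ball w R \<and> well_separated S z i}"
  define B where "B = {i. z i \<in> ball w R}"
  define I where "I = integral {0..1} (\<lambda>t. fock_modulus f (w + circlepath 0 R t))"
  define M where "M = 2 * (2 * R) powr N * exp (R\<^sup>2 / 2)"
  define V where "V = (\<lambda>i. (T (1 + cmod (z i)))\<^sup>2 * (log_star (T (1 + cmod (z i)))) ^ 4)"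
  have L: "L \<ge> 1" using l by simp
  have "l * R \<le> R" using l R by (simp add: mult_left_le_one_le)
  moreover have "0 \<le> ln (1 + R)" using R by simp
  ultimately have TR: "T (1 + cmod w) \<le> R" using s R by linarith
  have B: "finite B" "real (card B) \<le> N" using card_perturbed_le[OF P L R TR] LN by (auto simp: B_def)
  have JB: "J \<subseteq> B" by (auto simp: J_def B_def)
  have J: "finite J" "real (card J) \<le> N"
    using finite_subset[OF JB B(1)] card_mono[OF B(1) JB] B(2) by auto
  have N0: "N \<ge> 0" using J(2) of_nat_0_le_iff[of "card J"] by linarith
  have M0: "M \<ge> 0" by (simp add: M_def)
  have fmc: "continuous_on UNIV (fock_modulus f)"
    by (rule holomorphic_fock_modulus_continuous[OF f])
  have cont: "continuous_on {0..1} (\<lambda>t. fock_modulus f (w + circlepath 0 R t))"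
    by (rule continuous_on_compose2[OF fmc]) (auto simp: circlepath_def part_circlepath_def intro!: continuous_intros)
  have I0: "I \<ge> 0" unfolding I_def by (intro integral_nonneg integrable_continuous_real cont) auto
  have Ip: "I powr p \<le> integral {0..1} (\<lambda>t. fock_modulus f (w + circlepath 0 R t) powr p)"
    unfolding I_def by (rule integral_powr_le[OF p cont]) auto
  have "fock_modulus f w \<le> exp (- (l * R\<^sup>2 / 4)) * I
    + (\<Sum>i\<in>J. 2 * (2 * R) ^ card J * exp (R\<^sup>2 / 2) * (fock_modulus f (z i) / S (cmod (z i))))"
    unfolding I_def by (rule local_interpolation[OF P sep l _ \<beta> s r0 f J_def]) (use R in simp)
  also have "\<dots> \<le> exp (- (l * R\<^sup>2 / 4)) * I + (\<Sum>i\<in>J. M * exp (V i) * fock_modulus f (z i))"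
  proof (intro add_left_mono sum_mono)
    fix i
    have "(2 * R) ^ card J = (2 * R) powr real (card J)" using R by (simp add: powr_realpow)
    also have "\<dots> \<le> (2 * R) powr N" by (rule powr_mono) (use J R in auto)
    finally have a: "2 * (2 * R) ^ card J * exp (R\<^sup>2 / 2) \<le> M" unfolding M_def by simp
    have "1 / S (cmod (z i)) \<le> exp (V i)" unfolding V_def by (rule separation_weight_le[OF P sep])
    then have b: "fock_modulus f (z i) * (1 / S (cmod (z i))) \<le> fock_modulus f (z i) * exp (V i)"
      by (rule mult_left_mono) simp
    have "2 * (2 * R) ^ card J * exp (R\<^sup>2 / 2) * (fock_modulus f (z i) * (1 / S (cmod (z i)))) \<le> M * (fock_modulus f (z i) * exp (V i))"
    proof (rule mult_mono[OF a b M0])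
      have "S (cmod (z i)) > 0" using sep by (simp add: separation_condition_def)
      then show "0 \<le> fock_modulus f (z i) * (1 / S (cmod (z i)))" by simp
    qed
    then show "2 * (2 * R) ^ card J * exp (R\<^sup>2 / 2) * (fock_modulus f (z i) / S (cmod (z i))) \<le> M * exp (V i) * fock_modulus f (z i)"
      by (simp add: mult_ac)
  qed
  finally have "fock_modulus f w powr p \<le> (exp (- (l * R\<^sup>2 / 4)) * I + (\<Sum>i\<in>J. M * exp (V i) * fock_modulus f (z i))) powr p"
    using p by (intro powr_mono2) auto
  also have "\<dots> \<le> (real (card J) + 1) powr p * ((exp (- (l * R\<^sup>2 / 4)) * I) powr p + (\<Sum>i\<in>J. (M * exp (V i) * fock_modulus f (z i)) powr p))"
    by (rule powr_add_sum_le[OF J(1)]) (use p I0 M0 in auto)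
  also have "\<dots> \<le> (N + 1) powr p * (exp (- (p * l * R\<^sup>2 / 4)) * integral {0..1} (\<lambda>t. fock_modulus f (w + circlepath 0 R t) powr p)
       + (\<Sum>i\<in>B. M powr p * exp (p * V i) * fock_modulus f (z i) powr p))"
  proof (rule mult_mono)
    show "(real (card J) + 1) powr p \<le> (N + 1) powr p" using J p by (intro powr_mono2) auto
    have e: "exp x powr p = exp (p * x)" for x by (simp add: exp_powr_real mult.commute)
    have "(exp (- (l * R\<^sup>2 / 4)) * I) powr p = exp (- (p * l * R\<^sup>2 / 4)) * I powr p"
      using I0 by (simp add: powr_mult e mult.assoc)
    also have "\<dots> \<le> exp (- (p * l * R\<^sup>2 / 4)) * integral {0..1} (\<lambda>t. fock_modulus f (w + circlepath 0 R t) powr p)"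
      by (rule mult_left_mono[OF Ip]) simp
    finally have 1: "(exp (- (l * R\<^sup>2 / 4)) * I) powr p \<le> exp (- (p * l * R\<^sup>2 / 4)) * integral {0..1} (\<lambda>t. fock_modulus f (w + circlepath 0 R t) powr p)" .
    have "(\<Sum>i\<in>J. (M * exp (V i) * fock_modulus f (z i)) powr p) = (\<Sum>i\<in>J. M powr p * exp (p * V i) * fock_modulus f (z i) powr p)"
      using M0 by (simp add: powr_mult e)
    also have "\<dots> \<le> (\<Sum>i\<in>B. M powr p * exp (p * V i) * fock_modulus f (z i) powr p)"
      by (rule sum_mono2[OF B(1) JB]) auto
    finally show "(exp (- (l * R\<^sup>2 / 4)) * I) powr p + (\<Sum>i\<in>J. (M * exp (V i) * fock_modulus f (z i)) powr p)
      \<le> exp (- (p * l * R\<^sup>2 / 4)) * integral {0..1} (\<lambda>t. fock_modulus f (w + circlepath 0 R t) powr p)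
       + (\<Sum>i\<in>B. M powr p * exp (p * V i) * fock_modulus f (z i) powr p)"
      using 1 by (rule add_mono[rotated])
  qed (auto intro!: add_nonneg_nonneg sum_nonneg)
  finally show ?thesis
    unfolding B_def M_def V_def by (simp only: distrib_left sum_distrib_left mult.assoc)
qed

section \<open>Integration over the centres\<close>

lemma ennreal_integral_circle:
  fixes h :: "complex \<Rightarrow> real"
  assumes h: "continuous_on UNIV h" "\<And>u. h u \<ge> 0"
  shows "ennreal (integral {0..1} (\<lambda>t. h (w + circlepath 0 r t))) =
    (\<integral>\<^sup>+ t. indicator {0..1} t * ennreal (h (w + circlepath 0 r t)) \<partial>lborel)"
proof -
  have cont: "continuous_on UNIV (\<lambda>t. h (w + circlepath 0 r t))"
    by (rule continuous_on_compose2[OF h(1)]) (auto simp: circlepath_def part_circlepath_def intro!: continuous_intros)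
  then have [measurable]: "(\<lambda>t. h (w + circlepath 0 r t)) \<in> borel_measurable borel"
    by (rule borel_measurable_continuous_onI)
  have "(\<lambda>t. h (w + circlepath 0 r t)) integrable_on {0..1}"
    by (rule integrable_continuous_real) (rule continuous_on_subset[OF cont], simp)
  then have "((\<lambda>t. if t \<in> {0..1} then h (w + circlepath 0 r t) else 0) has_integral
      integral {0..1} (\<lambda>t. h (w + circlepath 0 r t))) UNIV"
    unfolding has_integral_restrict_UNIV by (rule integrable_integral)
  then have "(\<integral>\<^sup>+ t. ennreal (if t \<in> {0..1} then h (w + circlepath 0 r t) else 0) \<partial>lborel) =
      ennreal (integral {0..1} (\<lambda>t. h (w + circlepath 0 r t)))"
    by (rule nn_integral_has_integral_lborel[rotated 2]) (use h in auto)
  moreover have "(\<integral>\<^sup>+ t. ennreal (if t \<in> {0..1} then h (w + circlepath 0 r t) else 0) \<partial>lborel) =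
     (\<integral>\<^sup>+ t. indicator {0..1} t * ennreal (h (w + circlepath 0 r t)) \<partial>lborel)"
    by (rule nn_integral_cong) (simp add: indicator_def)
  ultimately show ?thesis by simp
qed

text \<open>
The order of integration is exchanged; for each point of the circle the inner integral is that of a
translate of \<open>h\<close>.
\<close>
lemma nn_integral_circle_means:
  fixes h :: "complex \<Rightarrow> real"
  assumes h: "continuous_on UNIV h" "\<And>u. h u \<ge> 0"
  shows "(\<integral>\<^sup>+ w. ennreal (integral {0..1} (\<lambda>t. h (w + circlepath 0 r t))) \<partial>lborel) = (\<integral>\<^sup>+ w. ennreal (h w) \<partial>lborel)"
proof -
  have hm [measurable]: "h \<in> borel_measurable borel" by (rule borel_measurable_continuous_onI[OF h(1)])
  have "continuous_on UNIV (circlepath 0 r)"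
    by (simp add: circlepath_def part_circlepath_def continuous_intros)
  then have [measurable]: "circlepath 0 r \<in> borel_measurable borel"
    by (rule borel_measurable_continuous_onI)
  have ps: "pair_sigma_finite (lborel :: real measure) (lborel :: complex measure)"
    by (intro pair_sigma_finite.intro lborel.sigma_finite_measure_axioms)
  have "(\<integral>\<^sup>+ w. ennreal (integral {0..1} (\<lambda>t. h (w + circlepath 0 r t))) \<partial>lborel) =
      (\<integral>\<^sup>+ w. (\<integral>\<^sup>+ t. indicator {0..1} t * ennreal (h (w + circlepath 0 r t)) \<partial>lborel) \<partial>lborel)"
    unfolding ennreal_integral_circle[OF h] ..
  also have "\<dots> = (\<integral>\<^sup>+ t. (\<integral>\<^sup>+ w. indicator {0..1} t * ennreal (h (w + circlepath 0 r t)) \<partial>lborel) \<partial>lborel)"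
    by (rule pair_sigma_finite.Fubini'[OF ps]) measurable
  also have "\<dots> = (\<integral>\<^sup>+ t. indicator {0..1} (t::real) * (\<integral>\<^sup>+ w. ennreal (h w) \<partial>lborel) \<partial>lborel)"
  proof (rule nn_integral_cong)
    fix t :: real
    have "(\<integral>\<^sup>+ w. ennreal (h w) \<partial>lborel) = (\<integral>\<^sup>+ w. ennreal (h w) \<partial>distr lborel borel ((+) (circlepath 0 r t)))"
      by (simp only: lborel_distr_plus)
    also have "\<dots> = (\<integral>\<^sup>+ w. ennreal (h (circlepath 0 r t + w)) \<partial>lborel)"
      by (rule nn_integral_distr) measurable
    finally have "(\<integral>\<^sup>+ w. ennreal (h (w + circlepath 0 r t)) \<partial>lborel) = (\<integral>\<^sup>+ w. ennreal (h w) \<partial>lborel)"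
      by (simp add: add.commute)
    then show "(\<integral>\<^sup>+ w. indicator {0..1} t * ennreal (h (w + circlepath 0 r t)) \<partial>lborel) =
        indicator {0..1} t * (\<integral>\<^sup>+ w. ennreal (h w) \<partial>lborel)"
      by (subst nn_integral_cmult) simp_all
  qed
  also have "\<dots> = (\<integral>\<^sup>+ w. ennreal (h w) \<partial>lborel)"
    by (subst nn_integral_multc) (auto simp: nn_integral_indicator)
  finally show ?thesis .
qed

text \<open>
By the previous lemma the first series integrates to half of the integral of \<open>h\<close>.  Finiteness of
this integral is what permits moving the half to the other side.
\<close>
lemma absorb_circle_means:
  fixes h :: "complex \<Rightarrow> real"
  assumes h: "continuous_on UNIV h" "\<And>u. h u \<ge> 0" and fin: "(\<integral>\<^sup>+ w. ennreal (h w) \<partial>lborel) < \<infinity>"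
    and pw: "\<And>w. ennreal (h w) \<le>
      (\<Sum>n. ennreal ((1/2) ^ (n + 2)) * ennreal (integral {0..1} (\<lambda>t. h (w + circlepath 0 (r n) t))))
      + (\<Sum>k::nat. W k * indicator (ball (c k) (\<rho> k)) w)"
  shows "(\<integral>\<^sup>+ w. ennreal (h w) \<partial>lborel) \<le> 2 * (\<Sum>k. W k * emeasure lborel (ball (c k) (\<rho> k)))"
proof -
  define X where "X = (\<integral>\<^sup>+ w. ennreal (h w) \<partial>lborel)"
  define Y where "Y = (\<Sum>k. W k * emeasure lborel (ball (c k) (\<rho> k)))"
  have hm [measurable]: "h \<in> borel_measurable borel" by (rule borel_measurable_continuous_onI[OF h(1)])
  have cm: "continuous_on UNIV (circlepath 0 s)" for s
    by (simp add: circlepath_def part_circlepath_def continuous_intros)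
  have [measurable]: "circlepath 0 s \<in> borel_measurable borel" for s
    by (rule borel_measurable_continuous_onI[OF cm])
  define A where "A = (\<lambda>n w. ennreal (integral {0..1} (\<lambda>t. h (w + circlepath 0 (r n) t))))"
  define D where "D = (\<lambda>k w. W k * indicator (ball (c k) (\<rho> k)) w :: ennreal)"
  have Am [measurable]: "A n \<in> borel_measurable lborel" for n
    unfolding A_def ennreal_integral_circle[OF h] by measurable
  have [measurable]: "ball (c k) (\<rho> k) \<in> sets borel" for k by simp
  have Dm [measurable]: "D k \<in> borel_measurable lborel" for k
    unfolding D_def by measurable
  have intA: "(\<integral>\<^sup>+ w. A n w \<partial>lborel) = X" for n
    unfolding A_def X_def by (rule nn_integral_circle_means[OF h])
  have half: "(\<Sum>n. ennreal ((1/2) ^ (n + 2))) = ennreal (1/2)"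
  proof -
    have "(\<lambda>n. (1/4) * (1/2::real) ^ n) sums ((1/4) * (1 / (1 - 1/2)))"
      by (intro sums_mult geometric_sums) simp
    then have "(\<lambda>n. (1/2::real) ^ (n + 2)) sums (1/2)" by (simp add: power_add mult.commute)
    then show ?thesis by (subst suminf_ennreal_eq) auto
  qed
  have "X \<le> (\<integral>\<^sup>+ w. ((\<Sum>n. ennreal ((1/2) ^ (n + 2)) * A n w) + (\<Sum>k. D k w)) \<partial>lborel)"
    unfolding X_def A_def D_def by (rule nn_integral_mono) (rule pw)
  also have "\<dots> = (\<integral>\<^sup>+ w. (\<Sum>n. ennreal ((1/2) ^ (n + 2)) * A n w) \<partial>lborel) + (\<integral>\<^sup>+ w. (\<Sum>k. D k w) \<partial>lborel)"
    by (rule nn_integral_add) measurable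
  also have "(\<integral>\<^sup>+ w. (\<Sum>n. ennreal ((1/2) ^ (n + 2)) * A n w) \<partial>lborel)
      = (\<Sum>n. \<integral>\<^sup>+ w. ennreal ((1/2) ^ (n + 2)) * A n w \<partial>lborel)"
    by (rule nn_integral_suminf) measurable
  also have "\<dots> = (\<Sum>n. ennreal ((1/2) ^ (n + 2)) * X)"
    by (subst nn_integral_cmult[OF Am]) (simp only: intA)
  also have "\<dots> = ennreal (1/2) * X" unfolding ennreal_suminf_multc half ..
  also have "(\<integral>\<^sup>+ w. (\<Sum>k. D k w) \<partial>lborel) = (\<Sum>k. \<integral>\<^sup>+ w. D k w \<partial>lborel)"
    by (rule nn_integral_suminf) measurable
  also have "\<dots> = Y" unfolding Y_def D_def
    by (rule suminf_cong) (simp add: nn_integral_cmult_indicator)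
  finally have le: "X \<le> ennreal (1/2) * X + Y" .
  have "X < \<infinity>" using fin by (simp add: X_def)
  then obtain x where x: "x \<ge> 0" "X = ennreal x" by (cases X) auto
  have "X \<le> 2 * Y"
  proof (cases Y)
    case (real y)
    have "ennreal (1/2 * x + y) = ennreal (1/2 * x) + ennreal y" by (rule ennreal_plus) (use x real in auto)
    also have "ennreal (1/2 * x) = ennreal (1/2) * ennreal x" by (rule ennreal_mult) (use x in auto)
    finally have "ennreal x \<le> ennreal (1/2 * x + y)" using le x real by simp
    then have "x \<le> 1/2 * x + y" using x real by (subst (asm) ennreal_le_iff) auto
    then have "x \<le> 2 * y" by simp
    then have "ennreal x \<le> ennreal (2 * y)" by (rule ennreal_leI)
    then show ?thesis using x real by (simp add: ennreal_mult)
  next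
    case top
    then show ?thesis by (simp add: ennreal_mult_top)
  qed
  then show ?thesis by (simp add: X_def Y_def)
qed

lemma infsum_ennreal_eq_suminf:
  fixes g :: "'a \<Rightarrow> ennreal"
  assumes e: "bij_betw e (UNIV :: nat set) UNIV"
  shows "(\<Sum>\<^sub>\<infinity>i\<in>UNIV. g i) = (\<Sum>k. g (e k))"
proof -
  have "(\<Sum>\<^sub>\<infinity>i\<in>UNIV. g i) = (\<Sum>\<^sub>\<infinity>k\<in>UNIV. g (e k))"
    using infsum_reindex_bij_betw[OF e, of g] by simp
  also have "\<dots> = (\<Sum>k. g (e k))"
    using has_sum_imp_sums[OF has_sum_infsum[OF nonneg_summable_on_complete[of UNIV "\<lambda>k. g (e k)"]]]
    by (simp add: sums_unique)
  finally show ?thesis .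
qed

lemma sum_le_suminf_enum:
  fixes g :: "'a \<Rightarrow> ennreal"
  assumes e: "bij_betw e (UNIV :: nat set) UNIV" and B: "finite B"
  shows "(\<Sum>i\<in>B. g i) \<le> (\<Sum>k. g (e k))"
proof -
  have inj: "inj e" and surj: "surj e" using e by (auto simp: bij_betw_def)
  have "(\<Sum>i\<in>B. g i) = (\<Sum>k\<in>e -` B. g (e k))"
    using sum.reindex[of e "e -` B" g] inj surj by (simp add: inj_on_def surj_image_vimage_eq)
  also have "\<dots> \<le> (\<Sum>k. g (e k))"
    by (rule sum_le_suminf) (use finite_vimageI[OF B inj] in auto)
  finally show ?thesis .
qed

section \<open>Choice of the radius\<close>

lemma exp7_ge: "exp (7::real) \<ge> 128"
proof -
  have "(2::real) ^ 7 \<le> exp 1 ^ 7"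
    using exp_ge_add_one_self[of "1::real"] by (intro power_mono) auto
  also have "exp 1 ^ 7 = exp (7::real)" by (simp add: exp_of_nat_mult[symmetric])
  finally show ?thesis by simp
qed

lemma ln2_le_one: "ln (2::real) \<le> 1"
  using ln_le_minus_one[of "2::real"] by simp

text \<open>
Throughout, \<open>x\<close> is a scale at least \<open>exp (\<kappa> \<beta> / l)\<close>.  As \<open>\<kappa>\<close> is large, \<open>x\<close> exceeds
the numerical constants that occur, and \<open>ln x \<ge> 1/l\<close> lets powers of \<open>1/l\<close> be absorbed into powers of
\<open>ln x\<close>; this is what keeps the exponents free of \<open>L - 1\<close> for large \<open>T\<close>.
\<close>
lemma scale_bounds:
  fixes \<kappa> \<beta> l x :: real
  assumes k: "\<kappa> \<ge> 7" and \<beta>: "\<beta> \<ge> 1" and l: "0 < l" "l \<le> 1" and x: "exp (\<kappa> * \<beta> / l) \<le> x"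
  shows "128 \<le> x" "\<kappa> * \<beta> / l \<le> ln x" "7 \<le> ln x" "1 / l \<le> ln x" "\<kappa> \<le> ln x" "ln x \<le> x" "ln (1 / l) \<le> ln x"
proof -
  have kb: "\<kappa> * 1 \<le> \<kappa> * \<beta>" using k \<beta> by (intro mult_left_mono) auto
  also have "\<dots> = \<kappa> * \<beta> / 1" by simp
  also have "\<dots> \<le> \<kappa> * \<beta> / l" using k \<beta> l by (intro divide_left_mono) auto
  finally have 1: "\<kappa> \<le> \<kappa> * \<beta> / l" by simp
  have "exp 7 \<le> exp (\<kappa> * \<beta> / l)" using 1 k by simp
  then show x128: "128 \<le> x" using x exp7_ge by linarith
  have "ln (exp (\<kappa> * \<beta> / l)) \<le> ln x" using x x128 by (subst ln_le_cancel_iff) auto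
  then show 2: "\<kappa> * \<beta> / l \<le> ln x" by simp
  show 3: "\<kappa> \<le> ln x" "7 \<le> ln x" using 1 2 k by auto
  have "1 * 1 \<le> \<kappa> * \<beta>" using k \<beta> by (intro mult_mono) auto
  then have "1 / l \<le> \<kappa> * \<beta> / l" using l by (intro divide_right_mono) auto
  then show 4: "1 / l \<le> ln x" using 2 by linarith
  show 5: "ln x \<le> x" using ln_le_minus_one[of x] x128 by simp
  have "ln (1 / l) \<le> 1 / l - 1" using l by (intro ln_le_minus_one) auto
  then show "ln (1 / l) \<le> ln x" using 4 by linarith
qed

lemma ln_scaled:
  fixes l x :: real
  assumes "0 < l" "x > 0"
  shows "ln (2 ^ m * x / l) \<le> real m + ln x + ln (1 / l)"
proof -
  have "ln (2 ^ m * x / l) = real m * ln 2 + ln x + ln (1 / l)"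
    using assms by (simp add: ln_mult ln_div ln_realpow)
  moreover have "real m * ln 2 \<le> real m * 1" using ln2_le_one by (intro mult_left_mono) auto
  ultimately show ?thesis by simp
qed

context
  fixes \<kappa> \<beta> l x R :: real
  assumes k: "\<kappa> \<ge> 7" and \<beta>: "\<beta> \<ge> 1" and l: "0 < l" "l \<le> 1" and x: "exp (\<kappa> * \<beta> / l) \<le> x"
    and R: "R = 1024 * x / l"
begin

lemma radius_ge: "1024 * x \<le> R"
proof -
  have "1024 * x / 1 \<le> 1024 * x / l"
    by (rule divide_left_mono) (use l scale_bounds(1)[OF k \<beta> l x] in auto)
  then show ?thesis by (simp add: R)
qed

text \<open>
The left side is at most \<open>3 x + 13 \<le> 16 x\<close>, and \<open>16 x = l R / 64\<close> is where the factor \<open>1024\<close> in \<open>R\<close>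
comes from.
\<close>
lemma radius_slack: "\<tau> \<le> x \<Longrightarrow> \<tau> + ln (1 + R) + 2 \<le> l * R / 64"
proof -
  assume t: "\<tau> \<le> x"
  note sb = scale_bounds[OF k \<beta> l x]
  have "ln (1 + R) \<le> ln (2 ^ 11 * x / l)"
    using radius_ge sb(1) by (subst ln_le_cancel_iff) (auto simp: R l)
  also have "\<dots> \<le> 11 + ln x + ln (1 / l)" using ln_scaled[of l x 11] l sb(1) by simp
  also have "\<dots> \<le> 11 + x + x" using sb(6,7) by linarith
  finally have "\<tau> + ln (1 + R) + 2 \<le> 16 * x" using t sb(1) by linarith
  also have "16 * x = l * R / 64" using l by (simp add: R)
  finally show ?thesis .
qed

lemma radius_log: "ln (l * R / 8) \<ge> 1" "8 * \<beta> \<le> l * (ln (l * R / 8))\<^sup>2"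
proof -
  note sb = scale_bounds[OF k \<beta> l x]
  have lnx: "ln x \<le> ln (l * R / 8)" using l sb(1) by (subst ln_le_cancel_iff) (auto simp: R)
  then have 1: "\<kappa> * \<beta> / l \<le> ln (l * R / 8)" using sb(2) by linarith
  show "ln (l * R / 8) \<ge> 1" using sb(3) lnx by linarith
  have "8 * \<beta> \<le> \<kappa> * \<kappa> * \<beta>" using k \<beta> mult_mono[of 7 \<kappa> 7 \<kappa>] by (intro mult_right_mono) auto
  also have "\<kappa> * \<kappa> * \<beta> * 1 \<le> \<kappa> * \<kappa> * \<beta> * (\<beta> / l)"
    using k \<beta> l by (intro mult_left_mono) (auto simp: le_divide_eq)
  also have "\<dots> = l * (\<kappa> * \<beta> / l)\<^sup>2" using l by (simp add: power2_eq_square)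
  also have "\<dots> \<le> l * (ln (l * R / 8))\<^sup>2"
    using 1 l k \<beta> by (intro mult_left_mono power_mono) auto
  finally show "8 * \<beta> \<le> l * (ln (l * R / 8))\<^sup>2" by simp
qed

lemma count_bound_le:
  assumes "1 \<le> L0" "L0 \<le> \<kappa>"
  shows "225 * L0 * R\<^sup>2 + 1 \<le> R ^ 4"
proof -
  note sb = scale_bounds[OF k \<beta> l x]
  have R1: "R \<ge> 1" using radius_ge sb(1) by linarith
  have "225 * L0 * R\<^sup>2 + 1 \<le> 226 * L0 * R\<^sup>2"
    using assms R1 mult_mono[of 1 L0 1 "R\<^sup>2"] by simp
  also have "226 * L0 \<le> R" using assms sb radius_ge by linarith
  then have "226 * L0 * R\<^sup>2 \<le> R * R\<^sup>2" by (intro mult_right_mono) auto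
  also have "\<dots> \<le> (R * R) * R\<^sup>2" using R1 by (intro mult_right_mono) auto
  also have "\<dots> = R ^ 4" by (simp add: power2_eq_square power4_eq_xxxx)
  finally show ?thesis .
qed

text \<open>
Since \<open>l R\<^sup>2 / 4 = 256 x R\<close>, the Gaussian gain beats both the polynomial factor from the number of
points and the target \<open>2\<^sup>-\<^sup>n\<^sup>-\<^sup>2\<close>.
\<close>
lemma decay_factor_le:
  assumes p: "p \<ge> 1" and L0: "1 \<le> L0" "L0 \<le> \<kappa>" and n: "x = real n"
  shows "(225 * L0 * R\<^sup>2 + 1) powr p * exp (- (p * l * R\<^sup>2 / 4)) \<le> (1/2) ^ (n + 2)"
proof -
  note sb = scale_bounds[OF k \<beta> l x]
  have R1: "R \<ge> 1" using radius_ge sb(1) by linarith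
  define X where "X = (225 * L0 * R\<^sup>2 + 1) * exp (- (l * R\<^sup>2 / 4))"
  have X0: "X \<ge> 0" using L0 by (simp add: X_def)
  have e1: "l * R\<^sup>2 / 4 = 256 * x * R" using l by (simp add: R power2_eq_square)
  have e2: "R ^ 4 \<le> exp (4 * R)"
  proof -
    have "R \<le> exp R" using exp_ge_add_one_self[of R] by linarith
    then have "R ^ 4 \<le> exp R ^ 4" using R1 by (intro power_mono) auto
    then show ?thesis by (simp add: exp_of_nat_mult[symmetric])
  qed
  have "X \<le> exp (4 * R) * exp (- (256 * x * R))"
    unfolding X_def e1 by (rule mult_right_mono[OF order_trans[OF count_bound_le[OF L0] e2]]) simp
  also have "\<dots> = exp (4 * R - 256 * x * R)" by (simp add: exp_diff exp_minus inverse_eq_divide)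
  also have "\<dots> \<le> exp (- real (n + 2))"
  proof -
    have "6 * R \<le> x * R" using sb(1) R1 by (intro mult_right_mono) auto
    moreover have "x * 1 \<le> x * R" using sb(1) R1 by (intro mult_left_mono) auto
    moreover have "256 * x * R = 256 * (x * R)" by simp
    moreover have "real (n + 2) = x + 2" using n by simp
    ultimately have "4 * R - 256 * x * R \<le> - real (n + 2)" using sb(1) R1 by linarith
    then show ?thesis by simp
  qed
  also have "\<dots> = exp (-1) ^ (n + 2)" by (simp only: exp_of_nat_mult[symmetric]) simp
  also have "\<dots> \<le> (1/2) ^ (n + 2)"
  proof (rule power_mono)
    have "2 \<le> exp (1::real)" using exp_ge_add_one_self[of "1::real"] by simp
    then show "exp (- 1 :: real) \<le> 1 / 2" by (simp add: exp_minus field_simps)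
  qed simp
  finally have X: "X \<le> (1/2) ^ (n + 2)" .
  have "(1/2::real) ^ (n + 2) \<le> 1" by (rule power_le_one) auto
  then have X1: "X \<le> 1" using X by linarith
  have e: "exp y powr p = exp (p * y)" for y by (simp add: exp_powr_real mult.commute)
  have "(225 * L0 * R\<^sup>2 + 1) powr p * exp (- (p * l * R\<^sup>2 / 4)) = X powr p"
    unfolding X_def using L0 by (simp add: powr_mult e mult.assoc)
  also have "\<dots> \<le> X powr 1"
  proof (cases "X = 0")
    case False
    then show ?thesis using X0 X1 p by (intro powr_mono') auto
  qed (use p in simp)
  also have "\<dots> = X" using X0 by simp
  finally show ?thesis using X by linarith
qed

text \<open>
The number of points accounts for \<open>225\<close> in the constant; the polynomial factor \<open>R\<^sup>4\<close>, the factor \<open>2\<close>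
and the Gaussian \<open>exp (R\<^sup>2 / 2)\<close> take the rest.
\<close>
lemma interpolation_factor_le:
  assumes p: "p \<ge> 1" and L0: "1 \<le> L0" "L0 \<le> \<kappa>"
  shows "(225 * L0 * R\<^sup>2 + 1) powr p * (2 * (2 * R) powr (225 * L0 * R\<^sup>2) * exp (R\<^sup>2 / 2)) powr p
    \<le> exp (231 * p * L0 * (R\<^sup>2 * ln (2 * R)))"
proof -
  note sb = scale_bounds[OF k \<beta> l x]
  have R1: "R \<ge> 4" using radius_ge sb(1) by linarith
  define N where "N = 225 * L0 * R\<^sup>2"
  have N0: "N \<ge> 0" using L0 by (simp add: N_def)
  define lg where "lg = ln (2 * R)"
  have "ln (exp 1) \<le> ln (2 * R)" using R1 exp_le by (subst ln_le_cancel_iff) auto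
  then have lg1: "lg \<ge> 1" by (simp add: lg_def)
  have lR: "ln R \<le> lg" "ln 2 \<le> lg" using R1 unfolding lg_def by simp_all
  let ?U = "L0 * (R\<^sup>2 * lg)"
  have R2: "1 \<le> R\<^sup>2" using R1 by simp
  have U: "lg \<le> ?U" "R\<^sup>2 \<le> ?U"
  proof -
    have "1 * (1 * lg) \<le> L0 * (R\<^sup>2 * lg)" using L0 R2 lg1 by (intro mult_mono) auto
    then show "lg \<le> ?U" by simp
    have "1 * (R\<^sup>2 * 1) \<le> L0 * (R\<^sup>2 * lg)" using L0 R2 lg1 by (intro mult_mono) auto
    then show "R\<^sup>2 \<le> ?U" by simp
  qed
  have "(N + 1) * (2 * (2 * R) powr N * exp (R\<^sup>2 / 2)) \<le> exp (4 * lg) * (exp lg * exp (N * lg) * exp (R\<^sup>2 / 2))"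
  proof (intro mult_mono)
    have "N + 1 \<le> R ^ 4" unfolding N_def by (rule count_bound_le[OF L0])
    also have "R ^ 4 = exp (ln R) ^ 4" using R1 by simp
    also have "\<dots> = exp (4 * ln R)" by (simp only: exp_of_nat_mult[symmetric]) simp
    also have "\<dots> \<le> exp (4 * lg)" using lR by simp
    finally show "N + 1 \<le> exp (4 * lg)" .
    show "2 \<le> exp lg" using R1 by (simp add: lg_def)
    show "(2 * R) powr N \<le> exp (N * lg)" using R1 by (simp add: powr_def lg_def)
  qed (use N0 in auto)
  also have "\<dots> = exp (4 * lg + lg + N * lg + R\<^sup>2 / 2)" by (simp only: exp_add mult.assoc)
  also have "\<dots> \<le> exp (231 * ?U)"
  proof -
    have "N * lg = 225 * ?U" by (simp add: N_def)
    then show ?thesis using U lg1 unfolding exp_le_cancel_iff by linarith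
  qed
  finally have le: "(N + 1) * (2 * (2 * R) powr N * exp (R\<^sup>2 / 2)) \<le> exp (231 * ?U)" .
  have "(N + 1) powr p * (2 * (2 * R) powr N * exp (R\<^sup>2 / 2)) powr p = ((N + 1) * (2 * (2 * R) powr N * exp (R\<^sup>2 / 2))) powr p"
    by (rule powr_mult[symmetric])
  also have "\<dots> \<le> exp (231 * ?U) powr p"
    by (rule powr_mono2[OF _ _ le]) (use N0 p in auto)
  also have "\<dots> = exp (p * (231 * ?U))" by (simp add: exp_powr_real mult.commute)
  finally show ?thesis by (simp add: N_def lg_def mult_ac)
qed

end

text \<open>
If a centre at scale \<open>x\<close> uses a point at scale \<open>y\<close> then \<open>x\<close> exceeds \<open>y\<close> by at most
\<open>ln (1 + R) \<le> 24 + x / 64\<close>, which is at most \<open>x / 2\<close>.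
\<close>
lemma scale_comparable:
  fixes \<kappa> \<beta> l x y R :: real
  assumes k: "\<kappa> \<ge> 7" and \<beta>: "\<beta> \<ge> 1" and l: "0 < l" "l \<le> 1" and x: "exp (\<kappa> * \<beta> / l) \<le> x"
    and R: "0 \<le> R" "R \<le> 2048 * x / l" and xy: "x \<le> y + ln (1 + R)"
  shows "x \<le> 2 * y"
proof -
  note sb = scale_bounds[OF k \<beta> l x]
  have "2048 * x / 1 \<le> 2048 * x / l"
    by (rule divide_left_mono) (use l sb(1) in auto)
  then have "1 + R \<le> 2 ^ 12 * x / l" using R sb(1) by simp
  then have "ln (1 + R) \<le> ln (2 ^ 12 * x / l)" using R sb(1) l by (subst ln_le_cancel_iff) auto
  also have "\<dots> \<le> 12 + ln x + ln (1 / l)" using ln_scaled[of l x 12] l sb(1) by simp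
  also have "\<dots> \<le> 12 + 2 * ln x" using sb(7) by simp
  also have "ln x = ln (x / 128) + ln (2 ^ 7)" using sb(1) by (simp add: ln_div)
  also have "ln (x / 128) \<le> x / 128 - 1" using sb(1) by (intro ln_le_minus_one) auto
  also have "ln (2 ^ 7 :: real) \<le> 7" using ln2_le_one by (subst ln_realpow) auto
  finally have "ln (1 + R) \<le> 12 + 2 * (x / 128 - 1 + 7)" by simp
  moreover have "x \<le> 2 * y" if "t \<le> 12 + 2 * (x / 128 - 1 + 7)" "x \<le> y + t" for t
    using that sb(1) by (simp add: field_simps)
  ultimately show ?thesis using xy by blast
qed

text \<open>
If \<open>\<tau>\<close> is the larger of the two numbers defining \<open>x\<close>, the factor \<open>1/l\<^sup>2\<close> is absorbed by
\<open>(ln \<tau>)\<^sup>2\<close>, which together with one more logarithm stays below the fourth power in the weight.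
Otherwise the exponent is a constant of size \<open>exp (5 \<kappa> \<beta> / l)\<close>.
\<close>
lemma weight_exponent_le:
  fixes \<kappa> \<beta> l x R :: real
  assumes k: "\<kappa> \<ge> 7" and \<beta>: "\<beta> \<ge> 1" and l: "0 < l" "l \<le> 1"
    and x: "x = max \<tau> (exp (\<kappa> * \<beta> / l))" and \<tau>: "1 \<le> \<tau>"
    and R: "R = 4096 * x / l"
  shows "R\<^sup>2 * ln (2 * R) \<le> 4096\<^sup>2 * 15 * (exp (5 * \<kappa> * \<beta> / l) + \<tau>\<^sup>2 * (log_star \<tau>) ^ 4)"
proof -
  have xx: "exp (\<kappa> * \<beta> / l) \<le> x" by (simp add: x)
  note sb = scale_bounds[OF k \<beta> l xx]
  have "ln (2 * R) = ln (2 ^ 13 * x / l)" by (simp add: R)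
  also have "\<dots> \<le> 13 + ln x + ln (1 / l)" using ln_scaled[of l x 13] l sb(1) by simp
  also have "\<dots> \<le> 15 * ln x" using sb by linarith
  finally have 1: "ln (2 * R) \<le> 15 * ln x" .
  have "R\<^sup>2 = 4096\<^sup>2 * x\<^sup>2 * (1 / l)\<^sup>2" by (simp add: R power_mult_distrib power_divide)
  also have "\<dots> \<le> 4096\<^sup>2 * x\<^sup>2 * (ln x)\<^sup>2"
    using sb l by (intro mult_left_mono power_mono) auto
  finally have 2: "R\<^sup>2 \<le> 4096\<^sup>2 * x\<^sup>2 * (ln x)\<^sup>2" .
  have "R\<^sup>2 * ln (2 * R) \<le> (4096\<^sup>2 * x\<^sup>2 * (ln x)\<^sup>2) * (15 * ln x)"
  proof (rule mult_mono[OF 2 1])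
    have "0 \<le> 2 * R - 1" using sb(1) l by (simp add: R divide_simps) 
    then show "0 \<le> ln (2 * R)" by simp
  qed auto
  also have "\<dots> = 4096\<^sup>2 * 15 * (x\<^sup>2 * (ln x) ^ 3)" by (simp add: power2_eq_square power3_eq_cube)
  also have "\<dots> \<le> 4096\<^sup>2 * 15 * (exp (5 * \<kappa> * \<beta> / l) + \<tau>\<^sup>2 * (log_star \<tau>) ^ 4)"
  proof (rule mult_left_mono)
    show "x\<^sup>2 * (ln x) ^ 3 \<le> exp (5 * \<kappa> * \<beta> / l) + \<tau>\<^sup>2 * (log_star \<tau>) ^ 4"
    proof (cases "\<tau> \<le> exp (\<kappa> * \<beta> / l)")
      case True
      then have xe: "x = exp (\<kappa> * \<beta> / l)" by (simp add: x)
      have "x\<^sup>2 * (ln x) ^ 3 \<le> x\<^sup>2 * x ^ 3" using sb by (intro mult_left_mono power_mono) auto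
      also have "\<dots> = x ^ 5" by (simp add: power_add[symmetric])
      also have "\<dots> = exp (5 * \<kappa> * \<beta> / l)" unfolding xe by (simp add: exp_of_nat_mult[symmetric])
      finally show ?thesis by (simp add: add_increasing2)
    next
      case False
      then have xt: "x = \<tau>" by (simp add: x)
      have "(ln x) ^ 3 \<le> (log_star \<tau>) ^ 3" using sb unfolding xt log_star_def by (intro power_mono) auto
      also have "\<dots> \<le> (log_star \<tau>) ^ 4" by (rule power_increasing) (auto simp: log_star_def)
      finally have "x\<^sup>2 * (ln x) ^ 3 \<le> \<tau>\<^sup>2 * (log_star \<tau>) ^ 4" unfolding xt by (rule mult_left_mono) simp
      then show ?thesis by (simp add: add_increasing)
    qed
  qed simp
  finally show ?thesis .
qed

section \<open>The sampling inequality\<close>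

lemma log_star_exp: "1 \<le> y \<Longrightarrow> log_star (exp y) = y"
  by (simp add: log_star_def)

text \<open>
The scale at \<open>u\<close> is \<open>max (T (1 + |u|)) (exp (\<kappa> \<beta> / l))\<close>, and the local estimate at \<open>w\<close> is used with
the radius \<open>1024 n / l\<close>, where \<open>n\<close> is the scale at \<open>w\<close> rounded up.  The point \<open>z i\<close> is used only from
centres closer than \<open>Rj i\<close>, so its total charge is \<open>W i\<close> times the area of that disc.
\<close>
lemma sampling_sum_bound:
  fixes p L0 :: real
  defines "\<kappa> \<equiv> L0 + 7" and "D \<equiv> 235 * p * L0 * (4096\<^sup>2 * 15)"
  assumes p: "1 \<le> p" and L: "1 < L" "L \<le> L0" and \<beta>: "1 \<le> \<beta>"
    and l_def: "l = min 1 (L - 1)"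
    and P: "perturbed_lattice L T z" and sep: "separation_condition \<beta> T S z"
    and f: "f holomorphic_on UNIV"
    and fin: "(\<integral>\<^sup>+ w. ennreal (fock_modulus f w powr p) \<partial>lborel) < \<infinity>"
  shows "(\<integral>\<^sup>+ w. ennreal (fock_modulus f w powr p) \<partial>lborel) \<le>
    ennreal (2 * exp (D * exp (5 * \<kappa> * \<beta> / l))) *
      (\<Sum>\<^sub>\<infinity>i\<in>UNIV. ennreal (sampling_weight (D + p) \<beta> T z i * fock_modulus f (z i) powr p))"
proof -
  have l: "0 < l" "l \<le> 1" "1 + l \<le> L" using L by (auto simp: l_def)
  have L01: "1 \<le> L0" "L0 \<le> \<kappa>" using L by (auto simp: \<kappa>_def)
  have k: "7 \<le> \<kappa>" using L by (simp add: \<kappa>_def)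
  define T0 where "T0 = exp (\<kappa> * \<beta> / l)"
  define \<tau> where "\<tau> = (\<lambda>u. T (1 + cmod u))"
  define x where "x = (\<lambda>u. max (\<tau> u) T0)"
  define V where "V = (\<lambda>i. (\<tau> (z i))\<^sup>2 * (log_star (\<tau> (z i))) ^ 4)"
  define r where "r = (\<lambda>n. 1024 * real n / l)"
  define Rj where "Rj = (\<lambda>i. 4096 * x (z i) / l)"
  define h where "h = (\<lambda>u. fock_modulus f u powr p)"
  define W where "W = (\<lambda>i. exp (231 * p * L0 * ((Rj i)\<^sup>2 * ln (2 * Rj i))) * exp (p * V i) * h (z i))"
  define e where "e = from_nat_into (UNIV :: (int \<times> int) set)"
  have e: "bij_betw e UNIV UNIV" unfolding e_def
    by (rule bij_betw_from_nat_into) (auto simp: infinite_UNIV_int finite_prod)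
  have \<tau>1: "1 \<le> \<tau> u" for u using P by (simp add: \<tau>_def perturbed_lattice_def)
  have h: "continuous_on UNIV h" "\<And>u. h u \<ge> 0"
  proof -
    show "continuous_on UNIV h" unfolding h_def
      by (rule continuous_on_powr') (use p holomorphic_fock_modulus_continuous[OF f] in auto)
  qed (simp add: h_def)
  have xT0: "exp (\<kappa> * \<beta> / l) \<le> x u" for u by (simp add: x_def T0_def)
  note sb = scale_bounds[OF k \<beta> l(1,2) xT0]
  have Rj2: "2 \<le> Rj i" for i
  proof -
    have "4096 * x (z i) / 1 \<le> Rj i" unfolding Rj_def
      by (rule divide_left_mono) (use l sb(1)[of "z i"] in auto)
    then show ?thesis using sb(1)[of "z i"] by linarith
  qed
  have lnRj: "1 \<le> ln (2 * Rj i)" for i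
  proof -
    have "ln (exp 1) \<le> ln (2 * Rj i)" using Rj2[of i] exp_le by (subst ln_le_cancel_iff) auto
    then show ?thesis by simp
  qed
  have pw: "ennreal (h w) \<le>
      (\<Sum>n. ennreal ((1/2) ^ (n + 2)) * ennreal (integral {0..1} (\<lambda>t. h (w + circlepath 0 (r n) t))))
      + (\<Sum>k::nat. ennreal (W (e k)) * indicator (ball (z (e k)) (Rj (e k))) w)" for w
  proof -
    define n where "n = nat \<lceil>x w\<rceil>"
    define R where "R = 1024 * real n / l"
    define B where "B = {i. z i \<in> ball w R}"
    define Q where "Q = exp (231 * p * L0 * (R\<^sup>2 * ln (2 * R)))"
    have n: "x w \<le> real n" "real n \<le> 2 * x w"
      using sb(1)[of w] unfolding n_def by linarith+
    have nT: "exp (\<kappa> * \<beta> / l) \<le> real n" using xT0[of w] n by linarith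
    note Rb = k \<beta> l(1,2) nT R_def
    have R1: "1 \<le> R" using radius_ge[OF Rb] n sb(1)[of w] by linarith
    have finB: "finite B" unfolding B_def by (rule finite_perturbed_ball[OF P]) (use L in simp)
    \<comment> \<open>Every centre that uses \<open>z i\<close> lies in the disc on which \<open>z i\<close> is charged.\<close>
    have RRj: "R \<le> Rj i" if i: "i \<in> B" for i
    proof -
      have d: "cmod (w - z i) < R" using i by (simp add: B_def dist_norm)
      have "\<tau> w \<le> \<tau> (z i) + ln (1 + cmod (w - z i))"
        unfolding \<tau>_def by (rule perturbed_lattice_slow_variation[OF P])
      also have "ln (1 + cmod (w - z i)) \<le> ln (1 + R)"
        using d R1 by (subst ln_le_cancel_iff) (auto simp: add_pos_nonneg)
      finally have "\<tau> w \<le> \<tau> (z i) + ln (1 + R)" by simp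
      moreover have "0 \<le> ln (1 + R)" using R1 by simp
      ultimately have xw: "x w \<le> x (z i) + ln (1 + R)" unfolding x_def by linarith
      have "1024 * real n / l \<le> 1024 * (2 * x w) / l"
        using n l by (intro divide_right_mono mult_left_mono) auto
      then have R2: "R \<le> 2048 * x w / l" by (simp add: R_def)
      have "x w \<le> 2 * x (z i)"
        by (rule scale_comparable[OF k \<beta> l(1,2) xT0 _ R2 xw]) (use R1 in simp)
      then have "2048 * x w / l \<le> 2048 * (2 * x (z i)) / l"
        using l by (intro divide_right_mono mult_left_mono) auto
      then show ?thesis using R2 by (simp add: Rj_def)
    qed
    have "h w \<le> (225 * L0 * R\<^sup>2 + 1) powr p * exp (- (p * l * R\<^sup>2 / 4)) * integral {0..1} (\<lambda>t. h (w + circlepath 0 R t))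
      + (\<Sum>i\<in>B. (225 * L0 * R\<^sup>2 + 1) powr p * (2 * (2 * R) powr (225 * L0 * R\<^sup>2) * exp (R\<^sup>2 / 2)) powr p
          * exp (p * (T (1 + cmod (z i)))\<^sup>2 * (log_star (T (1 + cmod (z i)))) ^ 4) * h (z i))"
      unfolding h_def B_def
    proof (rule local_estimate[OF P sep l R1 _ _ radius_log[OF Rb] f p])
      show "0 \<le> \<beta>" using \<beta> by simp
      show "T (1 + cmod w) + ln (1 + R) + 2 \<le> l * R / 64"
        by (rule radius_slack[OF Rb]) (use n in \<open>simp add: x_def \<tau>_def\<close>)
      show "225 * L * R\<^sup>2 \<le> 225 * L0 * R\<^sup>2" using L by (intro mult_right_mono) auto
    qed
    also have "\<dots> \<le> (1/2) ^ (n + 2) * integral {0..1} (\<lambda>t. h (w + circlepath 0 R t)) + (\<Sum>i\<in>B. W i)"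
    proof (rule add_mono)
      have "0 \<le> integral {0..1} (\<lambda>t. h (w + circlepath 0 R t))"
        by (rule Henstock_Kurzweil_Integration.integral_nonneg)
          (auto intro!: integrable_continuous_real continuous_on_compose2[OF h(1)] continuous_intros h(2)
            simp: circlepath_def part_circlepath_def)
      then show "(225 * L0 * R\<^sup>2 + 1) powr p * exp (- (p * l * R\<^sup>2 / 4)) * integral {0..1} (\<lambda>t. h (w + circlepath 0 R t))
          \<le> (1/2) ^ (n + 2) * integral {0..1} (\<lambda>t. h (w + circlepath 0 R t))"
        by (rule mult_right_mono[OF decay_factor_le[OF Rb p L01 refl]])
      show "(\<Sum>i\<in>B. (225 * L0 * R\<^sup>2 + 1) powr p * (2 * (2 * R) powr (225 * L0 * R\<^sup>2) * exp (R\<^sup>2 / 2)) powr p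
          * exp (p * (T (1 + cmod (z i)))\<^sup>2 * (log_star (T (1 + cmod (z i)))) ^ 4) * h (z i)) \<le> (\<Sum>i\<in>B. W i)"
      proof (rule sum_mono)
        fix i assume i: "i \<in> B"
        have V: "p * (T (1 + cmod (z i)))\<^sup>2 * (log_star (T (1 + cmod (z i)))) ^ 4 = p * V i"
          by (simp add: V_def \<tau>_def mult.assoc)
        have lnm: "ln (2 * R) \<le> ln (2 * Rj i)" using RRj[OF i] R1 by (subst ln_le_cancel_iff) auto
        have "R\<^sup>2 * ln (2 * R) \<le> (Rj i)\<^sup>2 * ln (2 * Rj i)"
          by (intro mult_mono power_mono RRj[OF i] lnm) (use R1 in auto)
        then have "231 * p * L0 * (R\<^sup>2 * ln (2 * R)) \<le> 231 * p * L0 * ((Rj i)\<^sup>2 * ln (2 * Rj i))"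
          using p L01 by (intro mult_left_mono) auto
        then have "exp (231 * p * L0 * (R\<^sup>2 * ln (2 * R))) \<le> exp (231 * p * L0 * ((Rj i)\<^sup>2 * ln (2 * Rj i)))"
          by simp
        then have "(225 * L0 * R\<^sup>2 + 1) powr p * (2 * (2 * R) powr (225 * L0 * R\<^sup>2) * exp (R\<^sup>2 / 2)) powr p
            \<le> exp (231 * p * L0 * ((Rj i)\<^sup>2 * ln (2 * Rj i)))"
          using interpolation_factor_le[OF Rb p L01] by linarith
        then show "(225 * L0 * R\<^sup>2 + 1) powr p * (2 * (2 * R) powr (225 * L0 * R\<^sup>2) * exp (R\<^sup>2 / 2)) powr p
          * exp (p * (T (1 + cmod (z i)))\<^sup>2 * (log_star (T (1 + cmod (z i)))) ^ 4) * h (z i) \<le> W i"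
          unfolding W_def V by (intro mult_right_mono) (auto simp: h(2))
      qed
    qed
    finally have le: "h w \<le> (1/2) ^ (n + 2) * integral {0..1} (\<lambda>t. h (w + circlepath 0 R t)) + (\<Sum>i\<in>B. W i)" .
    let ?I = "\<lambda>n. integral {0..1} (\<lambda>t. h (w + circlepath 0 (r n) t))"
    have W0: "0 \<le> W i" for i using h(2) by (simp add: W_def)
    have Rr: "R = r n" by (simp add: R_def r_def)
    have "ennreal (h w) \<le> ennreal ((1/2) ^ (n + 2) * ?I n + (\<Sum>i\<in>B. W i))"
      using le unfolding Rr by (rule ennreal_leI)
    also have "\<dots> = ennreal ((1/2) ^ (n + 2)) * ennreal (?I n) + (\<Sum>i\<in>B. ennreal (W i))"
    proof -
      have I0: "0 \<le> ?I n"
        by (rule Henstock_Kurzweil_Integration.integral_nonneg)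
          (auto intro!: integrable_continuous_real continuous_on_compose2[OF h(1)] continuous_intros h(2)
            simp: circlepath_def part_circlepath_def)
      have S: "(\<Sum>i\<in>B. ennreal (W i)) = ennreal (\<Sum>i\<in>B. W i)" by (rule sum_ennreal) (rule W0)
      have M: "ennreal ((1/2) ^ (n + 2) * ?I n) = ennreal ((1/2) ^ (n + 2)) * ennreal (?I n)"
        by (rule ennreal_mult) (use I0 in auto)
      show ?thesis unfolding S M[symmetric] by (rule ennreal_plus) (use I0 W0 in \<open>auto intro: sum_nonneg\<close>)
    qed
    also have "\<dots> \<le> (\<Sum>n. ennreal ((1/2) ^ (n + 2)) * ennreal (?I n))
      + (\<Sum>k::nat. ennreal (W (e k)) * indicator (ball (z (e k)) (Rj (e k))) w)"
    proof (rule add_mono)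
      show "ennreal ((1/2) ^ (n + 2)) * ennreal (?I n) \<le> (\<Sum>n. ennreal ((1/2) ^ (n + 2)) * ennreal (?I n))"
        using sum_le_suminf[of "\<lambda>n. ennreal ((1/2) ^ (n + 2)) * ennreal (?I n)" "{n}"] by simp
      have "(\<Sum>i\<in>B. ennreal (W i)) = (\<Sum>i\<in>B. ennreal (W i) * indicator (ball (z i) (Rj i)) w)"
      proof (rule sum.cong[OF refl])
        fix i assume i: "i \<in> B"
        then have "w \<in> ball (z i) (Rj i)" using RRj[OF i] by (auto simp: B_def dist_commute)
        then show "ennreal (W i) = ennreal (W i) * indicator (ball (z i) (Rj i)) w" by simp
      qed
      also have "\<dots> \<le> (\<Sum>k. ennreal (W (e k)) * indicator (ball (z (e k)) (Rj (e k))) w)"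
        by (rule sum_le_suminf_enum[OF e finB])
      finally show "(\<Sum>i\<in>B. ennreal (W i)) \<le> (\<Sum>k. ennreal (W (e k)) * indicator (ball (z (e k)) (Rj (e k))) w)" .
    qed
    finally show ?thesis .
  qed
  define K where "K = exp (D * exp (5 * \<kappa> * \<beta> / l))"
  define g where "g = (\<lambda>i. sampling_weight (D + p) \<beta> T z i * h (z i))"
  have D0: "0 \<le> D" using p L01 by (simp add: D_def)
  have summand: "ennreal (W i) * emeasure lborel (ball (z i) (Rj i)) \<le> ennreal K * ennreal (g i)" for i
  proof -
    define U where "U = (Rj i)\<^sup>2 * ln (2 * Rj i)"
    have V0: "0 \<le> V i" by (simp add: V_def)
    have pL: "1 \<le> p * L0" using p L01 mult_mono[of 1 p 1 L0] by simp
    have U: "(Rj i)\<^sup>2 \<le> U" unfolding U_def using mult_left_mono[OF lnRj[of i], of "(Rj i)\<^sup>2"] by simp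
    have U0: "0 \<le> U" using U by (rule order_trans[rotated]) simp
    have "pi * (Rj i)\<^sup>2 \<le> 4 * (Rj i)\<^sup>2" using pi_less_4 by (intro mult_right_mono) auto
    also have "\<dots> \<le> 4 * (p * L0 * U)" using U mult_right_mono[OF pL U0] by linarith
    also have "\<dots> \<le> exp (4 * (p * L0 * U))" using exp_ge_add_one_self[of "4 * (p * L0 * U)"] by linarith
    finally have area: "pi * (Rj i)\<^sup>2 \<le> exp (4 * (p * L0 * U))" .
    have "W i * (pi * (Rj i)\<^sup>2) \<le> W i * exp (4 * (p * L0 * U))"
      using area by (rule mult_left_mono) (simp add: W_def h(2))
    also have "\<dots> = exp (231 * p * L0 * U + p * V i + 4 * (p * L0 * U)) * h (z i)"
      unfolding W_def U_def[symmetric] exp_add by simp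
    also have "\<dots> \<le> exp (D * exp (5 * \<kappa> * \<beta> / l) + (D + p) * \<beta> * V i) * h (z i)"
    proof -
      have "U \<le> 4096\<^sup>2 * 15 * (exp (5 * \<kappa> * \<beta> / l) + V i)"
        unfolding U_def V_def
        by (rule weight_exponent_le[where x = "x (z i)" and \<tau> = "\<tau> (z i)", OF k \<beta> l(1,2) _ \<tau>1])
          (simp_all add: Rj_def x_def T0_def)
      then have "235 * p * L0 * U \<le> 235 * p * L0 * (4096\<^sup>2 * 15 * (exp (5 * \<kappa> * \<beta> / l) + V i))"
        using p L01 by (intro mult_left_mono) auto
      also have "\<dots> = D * exp (5 * \<kappa> * \<beta> / l) + D * V i" by (simp add: D_def distrib_left)
      finally have 1: "235 * p * L0 * U \<le> D * exp (5 * \<kappa> * \<beta> / l) + D * V i" .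
      have 2: "(D + p) * 1 * V i \<le> (D + p) * \<beta> * V i"
        using D0 p \<beta> V0 by (intro mult_right_mono mult_left_mono) auto
      have "231 * p * L0 * U + p * V i + 4 * (p * L0 * U) = 235 * p * L0 * U + p * V i" by simp
      then have "231 * p * L0 * U + p * V i + 4 * (p * L0 * U) \<le> D * exp (5 * \<kappa> * \<beta> / l) + (D + p) * \<beta> * V i"
        using 1 2 distrib_right[of D p "V i"] by linarith
      then show ?thesis by (intro mult_right_mono) (auto simp: h(2))
    qed
    also have "\<dots> = K * g i"
      by (simp add: K_def g_def sampling_weight_def V_def \<tau>_def exp_add mult.assoc)
    finally have le: "W i * (pi * (Rj i)\<^sup>2) \<le> K * g i" .
    have "emeasure lborel (ball (z i) (Rj i)) = ennreal (pi * (Rj i)\<^sup>2)"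
      using Rj2[of i] by (simp add: emeasure_ball unit_ball_vol_2)
    then have "ennreal (W i) * emeasure lborel (ball (z i) (Rj i)) = ennreal (W i * (pi * (Rj i)\<^sup>2))"
      by (simp only:) (rule ennreal_mult[symmetric], auto simp: W_def h(2))
    also have "\<dots> \<le> ennreal (K * g i)" using le by (rule ennreal_leI)
    also have "\<dots> = ennreal K * ennreal (g i)"
      by (rule ennreal_mult) (auto simp: K_def g_def sampling_weight_def h(2))
    finally show ?thesis .
  qed
  have "(\<integral>\<^sup>+ w. ennreal (h w) \<partial>lborel) \<le> 2 * (\<Sum>k. ennreal (W (e k)) * emeasure lborel (ball (z (e k)) (Rj (e k))))"
    by (rule absorb_circle_means[OF h _ pw]) (use fin in \<open>simp add: h_def\<close>)
  also have "\<dots> \<le> 2 * (\<Sum>k. ennreal K * ennreal (g (e k)))"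
    by (intro mult_left_mono suminf_le summand) auto
  also have "\<dots> = 2 * (ennreal K * (\<Sum>\<^sub>\<infinity>i\<in>UNIV. ennreal (g i)))"
    by (simp only: ennreal_suminf_cmult infsum_ennreal_eq_suminf[OF e])
  also have "\<dots> = ennreal (2 * K) * (\<Sum>\<^sub>\<infinity>i\<in>UNIV. ennreal (g i))"
    by (simp add: ennreal_mult' K_def mult.assoc)
  finally show ?thesis unfolding h_def g_def K_def .
qed

lemma fock_norm_pow_eq:
  "fock_norm_pow p f = ennreal (p / (2 * pi)) * (\<integral>\<^sup>+ w. ennreal (fock_modulus f w powr p) \<partial>lborel)"
  unfolding fock_norm_pow_def fock_modulus_powr by simp

text \<open>
Uniformity in \<open>L\<close> on \<open>(1, L0]\<close> serves both assertions of the theorem: \<open>L0 = L\<close> gives the first and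
\<open>L0 = 2\<close> the second.  The constant collects \<open>(p/\<pi>) exp (D exp (5 \<kappa> \<beta> / l))\<close> into a double exponential
of a multiple of \<open>\<beta> / l\<close>.
\<close>
lemma sampling_inequality_uniform:
  fixes p L0 :: real
  assumes p: "1 \<le> p" and L0: "1 < L0"
  shows "\<exists>C'\<ge>1. \<exists>C''\<ge>1. \<forall>L \<beta> T S z f. 1 < L \<longrightarrow> L \<le> L0 \<longrightarrow> 1 \<le> \<beta> \<longrightarrow>
    perturbed_lattice L T z \<longrightarrow> separation_condition \<beta> T S z \<longrightarrow> f \<in> fock_space p \<longrightarrow>
    sampling_inequality p (exp (exp (C'' * \<beta> / min 1 (L - 1)))) C' \<beta> T z f"
proof -
  define \<kappa> where "\<kappa> = L0 + 7"
  define D where "D = 235 * p * L0 * (4096\<^sup>2 * 15)"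
  have D0: "0 \<le> D" using p L0 by (simp add: D_def)
  define C'' where "C'' = 5 * \<kappa> + D + p"
  have "sampling_inequality p (exp (exp (C'' * \<beta> / min 1 (L - 1)))) (D + p) \<beta> T z f"
    if L: "1 < L" "L \<le> L0" and \<beta>: "1 \<le> \<beta>" and P: "perturbed_lattice L T z"
      and sep: "separation_condition \<beta> T S z" and f: "f \<in> fock_space p" for L \<beta> T S z f
  proof -
    define l where "l = min 1 (L - 1)"
    define X where "X = (\<integral>\<^sup>+ w. ennreal (fock_modulus f w powr p) \<partial>lborel)"
    define Y where "Y = (\<Sum>\<^sub>\<infinity>i\<in>UNIV. ennreal (sampling_weight (D + p) \<beta> T z i * fock_modulus f (z i) powr p))"
    have l: "0 < l" "l \<le> 1" using L by (auto simp: l_def)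
    have bl: "1 \<le> \<beta> / l" using \<beta> l by simp
    have "ennreal (p / (2 * pi)) * X < \<infinity>" using f by (simp add: fock_space_def fock_norm_pow_eq X_def)
    moreover have "0 < p / (2 * pi)" using p by simp
    ultimately have "X < \<infinity>" by (auto simp: ennreal_mult_less_top ennreal_eq_0_iff not_le simp del: zero_less_divide_iff)
    then have XY: "X \<le> ennreal (2 * exp (D * exp (5 * \<kappa> * \<beta> / l))) * Y"
      unfolding X_def Y_def \<kappa>_def D_def using f
      by (intro sampling_sum_bound[OF p L \<beta> l_def P sep]) (auto simp: fock_space_def)
    have const: "p / (2 * pi) * (2 * exp (D * exp (5 * \<kappa> * \<beta> / l))) \<le> exp (exp (C'' * \<beta> / l))"
    proof -
      define y where "y = D + 5 * \<kappa> * \<beta> / l"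
      have y0: "0 \<le> y" using D0 \<beta> l L0 by (auto simp: y_def \<kappa>_def)
      have "p / (2 * pi) * 2 = p / pi" by simp
      also have "\<dots> \<le> p / 1" using p pi_gt3 by (intro divide_left_mono) auto
      also have "\<dots> \<le> exp p" using exp_ge_add_one_self[of p] by linarith
      finally have "p / (2 * pi) * 2 * exp (D * exp (5 * \<kappa> * \<beta> / l)) \<le> exp p * exp (D * exp (5 * \<kappa> * \<beta> / l))"
        by (rule mult_right_mono) simp
      also have "\<dots> = exp (p + D * exp (5 * \<kappa> * \<beta> / l))" by (simp add: exp_add)
      also have "\<dots> \<le> exp (p + exp y)"
      proof -
        have "D \<le> exp D" using exp_ge_add_one_self[of D] by linarith
        then have "D * exp (5 * \<kappa> * \<beta> / l) \<le> exp D * exp (5 * \<kappa> * \<beta> / l)" by (rule mult_right_mono) simp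
        then show ?thesis by (simp add: y_def exp_add)
      qed
      also have "\<dots> \<le> exp (exp (p + y))"
      proof -
        have "(1 + p) * exp y \<le> exp p * exp y" using exp_ge_add_one_self[of p] by (intro mult_right_mono) auto
        moreover have "p * 1 \<le> p * exp y" using p y0 by (intro mult_left_mono) auto
        ultimately have "p + exp y \<le> exp (p + y)" by (simp add: exp_add algebra_simps)
        then show ?thesis by simp
      qed
      also have "\<dots> \<le> exp (exp (C'' * \<beta> / l))"
      proof -
        have "(p + D) * 1 \<le> (p + D) * (\<beta> / l)" using bl p D0 by (intro mult_left_mono) auto
        moreover have "C'' * \<beta> / l = (p + D) * (\<beta> / l) + 5 * \<kappa> * \<beta> / l"
          by (simp add: C''_def distrib_right add_divide_distrib)
        ultimately show ?thesis by (simp add: y_def)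
      qed
      finally show ?thesis by (simp add: mult.assoc)
    qed
    have "ennreal (p / (2 * pi)) * X \<le> ennreal (p / (2 * pi)) * (ennreal (2 * exp (D * exp (5 * \<kappa> * \<beta> / l))) * Y)"
      by (rule mult_left_mono[OF XY]) simp
    also have "\<dots> = ennreal (p / (2 * pi) * (2 * exp (D * exp (5 * \<kappa> * \<beta> / l)))) * Y"
      using p by (subst ennreal_mult) (auto simp: mult.assoc)
    also have "\<dots> \<le> ennreal (exp (exp (C'' * \<beta> / l))) * Y"
      by (rule mult_right_mono[OF ennreal_leI[OF const]]) simp
    finally show ?thesis
      unfolding sampling_inequality_def fock_norm_pow_eq X_def Y_def l_def
      by (simp only: fock_modulus_powr mult.assoc)
  qed
  moreover have "1 \<le> D + p" "1 \<le> C''" using D0 p L0 by (auto simp: C''_def \<kappa>_def)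
  ultimately show ?thesis by blast
qed

theorem proposition4p2:
  fixes p :: real
  assumes "1 \<le> p"
  shows "(\<forall>L>1. \<exists>C'\<ge>1. \<forall>\<beta>\<ge>1. \<exists>C\<ge>1.
            \<forall>T S z. perturbed_lattice L T z \<longrightarrow> separation_condition \<beta> T S z \<longrightarrow>
              (\<forall>f\<in>fock_space p. sampling_inequality p C C' \<beta> T z f)) \<and>
         (\<exists>C'\<ge>1. \<exists>C''. \<forall>L. 1 < L \<and> L < 2 \<longrightarrow> (\<forall>\<beta>\<ge>1. \<exists>C\<ge>1.
            log_star (log_star C) = C'' * \<beta> / (L - 1) \<and>
            (\<forall>T S z. perturbed_lattice L T z \<longrightarrow> separation_condition \<beta> T S z \<longrightarrow>
              (\<forall>f\<in>fock_space p. sampling_inequality p C C' \<beta> T z f))))"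
proof (rule conjI)
  show "\<forall>L>1. \<exists>C'\<ge>1. \<forall>\<beta>\<ge>1. \<exists>C\<ge>1.
            \<forall>T S z. perturbed_lattice L T z \<longrightarrow> separation_condition \<beta> T S z \<longrightarrow>
              (\<forall>f\<in>fock_space p. sampling_inequality p C C' \<beta> T z f)"
  proof (intro allI impI)
    fix L :: real assume L: "1 < L"
    obtain C' C'' where C': "1 \<le> C'" and "1 \<le> C''" and main: "\<forall>\<Lambda> \<beta> T S z f. 1 < \<Lambda> \<longrightarrow> \<Lambda> \<le> L \<longrightarrow> 1 \<le> \<beta> \<longrightarrow>
        perturbed_lattice \<Lambda> T z \<longrightarrow> separation_condition \<beta> T S z \<longrightarrow> f \<in> fock_space p \<longrightarrow>
        sampling_inequality p (exp (exp (C'' * \<beta> / min 1 (\<Lambda> - 1)))) C' \<beta> T z f"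
      using sampling_inequality_uniform[OF assms L] by blast
    show "\<exists>C'\<ge>1. \<forall>\<beta>\<ge>1. \<exists>C\<ge>1.
            \<forall>T S z. perturbed_lattice L T z \<longrightarrow> separation_condition \<beta> T S z \<longrightarrow>
              (\<forall>f\<in>fock_space p. sampling_inequality p C C' \<beta> T z f)"
    proof (rule exI[of _ C'], intro conjI C' allI impI)
      fix \<beta> :: real assume "1 \<le> \<beta>"
      then show "\<exists>C\<ge>1. \<forall>T S z. perturbed_lattice L T z \<longrightarrow> separation_condition \<beta> T S z \<longrightarrow>
              (\<forall>f\<in>fock_space p. sampling_inequality p C C' \<beta> T z f)"
        using main L by (intro exI[of _ "exp (exp (C'' * \<beta> / min 1 (L - 1)))"]) auto
    qed
  qed
next
  obtain C' C'' where C': "1 \<le> C'" and C'': "1 \<le> C''" and main: "\<forall>\<Lambda> \<beta> T S z f. 1 < \<Lambda> \<longrightarrow> \<Lambda> \<le> 2 \<longrightarrow> 1 \<le> \<beta> \<longrightarrow>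
      perturbed_lattice \<Lambda> T z \<longrightarrow> separation_condition \<beta> T S z \<longrightarrow> f \<in> fock_space p \<longrightarrow>
      sampling_inequality p (exp (exp (C'' * \<beta> / min 1 (\<Lambda> - 1)))) C' \<beta> T z f"
    using sampling_inequality_uniform[OF assms, of 2] by auto
  show "\<exists>C'\<ge>1. \<exists>C''. \<forall>L. 1 < L \<and> L < 2 \<longrightarrow> (\<forall>\<beta>\<ge>1. \<exists>C\<ge>1.
            log_star (log_star C) = C'' * \<beta> / (L - 1) \<and>
            (\<forall>T S z. perturbed_lattice L T z \<longrightarrow> separation_condition \<beta> T S z \<longrightarrow>
              (\<forall>f\<in>fock_space p. sampling_inequality p C C' \<beta> T z f)))"
  proof (rule exI[of _ C'], rule conjI[OF C'], rule exI[of _ C''], intro allI impI)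
    fix L \<beta> :: real assume L: "1 < L \<and> L < 2" and \<beta>: "1 \<le> \<beta>"
    have "1 * 1 \<le> C'' * \<beta>" using C'' \<beta> by (intro mult_mono) auto
    then have y: "1 \<le> C'' * \<beta> / (L - 1)" using L by (simp add: le_divide_eq)
    then have "1 \<le> exp (C'' * \<beta> / (L - 1))" by simp
    with y have "log_star (log_star (exp (exp (C'' * \<beta> / (L - 1))))) = C'' * \<beta> / (L - 1)"
      by (simp add: log_star_exp)
    moreover have "min 1 (L - 1) = L - 1" using L by simp
    ultimately show "\<exists>C\<ge>1. log_star (log_star C) = C'' * \<beta> / (L - 1) \<and>
            (\<forall>T S z. perturbed_lattice L T z \<longrightarrow> separation_condition \<beta> T S z \<longrightarrow>
              (\<forall>f\<in>fock_space p. sampling_inequality p C C' \<beta> T z f))"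
      using main L \<beta> by (intro exI[of _ "exp (exp (C'' * \<beta> / (L - 1)))"]) force
  qed
qed

end
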